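(* Let $\mathbb K$ be a field extension of $\mathbb Q$. Let $R$, $\tilde R$ and $\hat R$ be factorial Noetherian $\mathbb K$-algebras with no zero divisors and such that $R^\times=\tilde R^\times=\hat R^\times=\mathbb K^\times$, and let $(\mathcal C,R)$, $(\tilde{\mathcal C},\tilde R)$ and $(\hat{\mathcal C},\hat R)$ be cluster structures of geometric type in $R$, $\tilde R$ and $\hat R$, with fixed initial extended clusters $\mathbf x_0$, $\tilde{\mathbf x}_0$ and $\hat{\mathbf x}_0$. Assume the following: 1) there are markers $\kappa$ and $\kappa'$ that make $(\mathcal C,\tilde{\mathcal C},\kappa)$ and $(\mathcal C,\hat{\mathcal C},\kappa')$ related triples, as well as a pair of complementary birational quasi-isomorphisms $\mathcal Q:(\mathcal C,R)\to(\tilde{\mathcal C},\tilde R)$ and $\mathcal Q':(\mathcal C,R)\to(\hat{\mathcal C},\hat R)$; 2) the initial extended clusters $\tilde{\mathbf x}_0$ and $\hat{\mathbf x}_0$ are i-admissible; 3) the initial extended cluster $\mathbf x_0$ is regular. Then $\mathbf x_0$ is i-admissible, as well as $\bar{\mathcal A}_{\mathbb K}(\hat{\mathcal C})\subseteq\hat R$, $\bar{\mathcal A}_{\mathbb K}(\tilde{\mathcal C})\subseteq\tilde R$ and $\bar{\mathcal A}_{\mathbb K}(\mathcal C)\subseteq R$.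
   Context: Rings are commutative with $1$; $[a,b]=\{a,a+1,\dots,b\}$. Cluster structures. Let $\mathcal F$ be a field of rational functions in $N+M$ variables over $\mathbb Q$. An extended seed is a pair $\Sigma=(\mathbf x,B)$, where $\mathbf x=(x_1,\dots,x_{N+M})$ is a tuple of elements of $\mathcal F$ with $\mathcal F=\mathbb Q(x_1,\dots,x_{N+M})$ (the extended cluster), and $B=(b_{ij})$, $i\in[1,N]$, $j\in[1,N+M]$, is an integer matrix (the exchange matrix) whose first $N$ columns form a skew-symmetrizable matrix $B^{[1,N]}$ (there is a diagonal matrix $D$ with positive diagonal entries such that $DB^{[1,N]}$ is skew-symmetric). $x_1,\dots,x_N$ are cluster variables, $x_{N+1},\dots,x_{N+M}$ are frozen variables. The mutation of $\Sigma$ in direction $k\in[1,N]$ is the extended seed $((\mathbf x\setminus\{x_k\})\cup\{x_k'\},B')$ with $x_kx_k'=\prod_{b_{kj}>0}x_j^{b_{kj}}+\prod_{b_{kj}<0}x_j^{-b_{kj}}$, and $b'_{ij}=-b_{ij}$ if $i=k$ or $j=k$, $b'_{ij}=b_{ij}+\frac12(|b_{ik}|b_{kj}+b_{ik}|b_{kj}|)$ otherwise. The element $x_k'$ is the mutation of $x_k$. The collection $\mathcal C$ of all extended seeds obtained from an initial extended seed $\Sigma_0=(\mathbf x_0,B_0)$ by finite sequences of mutations is a cluster structure of geometric type of rank $N$, with ambient field $\mathcal F=\mathcal F_{\mathcal C}$. For an extended cluster $\mathbf x$, $\mathcal A(\mathbf x)=\mathbb Z[x_1,\dots,x_{N+M}]$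 and $\mathcal L(\mathbf x)=\mathbb Z[x_1^{\pm1},\dots,x_N^{\pm1},x_{N+1},\dots,x_{N+M}]$. The upper cluster algebra is $\bar{\mathcal A}(\mathcal C)=\bigcap_{\mathbf x\in\mathcal C}\mathcal L(\mathbf x)$ (over all extended clusters of $\mathcal C$), and $\bar{\mathcal A}_{\mathbb K}(\mathcal C)=\bar{\mathcal A}(\mathcal C)\otimes_{\mathbb Z}\mathbb K$. A cluster structure in an integral domain $R$ is a cluster structure $\mathcal C$ with an embedding $\mathcal A(\mathbf x_0)\hookrightarrow\operatorname{Frac}R$; then $\mathcal F_{\mathcal C}$ is identified with a subfield of $\operatorname{Frac}R$, and inclusions such as $\bar{\mathcal A}_{\mathbb K}(\mathcal C)\subseteq R$ are understood with respect to this identification. A variable is regular if it lies in $R$; a set of variables (in particular an extended cluster) is regular if all its elements are. Algebra. A factorial algebra is one whose underlying commutative ring is a UFD. $R^\times$ is the group of units of $R$. Two elements of $R$ are coprime if they are not contained in the same prime ideal of height $1$. An element of a UFD is irreducible if it is nonzero, not invertible, and whenever it equals $yz$, $y$ or $z$ is invertible. Related triples. Let $\mathcal C$ (rank $N$, $M$ frozen variables) and $\tilde{\mathcal C}$ (rank $\tilde N$, $\tilde M$ frozen variables) be cluster structures with $\tilde N<N$, $N+M=\tilde N+\tilde M$, and fixed initial extended seeds $(\mathbf x_0,B_0)$, $(\tilde{\mathbf x}_0,\tilde B_0)$, $\mathbf x_0=(x_1,\dots,x_{N+M})$, $\tilde{\mathbf x}_0=(\tilde x_1,\dots,\tilde x_{N+M})$.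 A marker is a bijection $\kappa:[1,N+M]\to[1,N+M]$ with $\kappa([N+1,N+M])\subset[\tilde N+1,\tilde N+\tilde M]$; then $(\mathcal C,\tilde{\mathcal C},\kappa)$ is called a related triple. Put $\tilde{\mathcal I}(\kappa)=[\tilde N+1,\tilde N+\tilde M]\cap\kappa([1,N])$ and $\mathcal I(\kappa)=\kappa^{-1}(\tilde{\mathcal I}(\kappa))\subseteq[1,N]$. The marked variables are $\mathbf x_0(\kappa)=\{x_i\in\mathbf x_0: i\in\mathcal I(\kappa)\}$ in $\mathcal C$ and $\tilde{\mathbf x}_0(\kappa)=\{\tilde x_i\in\tilde{\mathbf x}_0: i\in\tilde{\mathcal I}(\kappa)\}$ in $\tilde{\mathcal C}$. An extended seed (and its extended cluster) of $\mathcal C$ is marked (relative to the triple) if it is obtained from the initial one by mutations in directions $i_1,\dots,i_m\in[1,N]\setminus\mathcal I(\kappa)$; the extended seed of $\tilde{\mathcal C}$ obtained from the initial one by mutations in directions $\kappa(i_1),\dots,\kappa(i_m)$ is related to it, and the corresponding extended clusters are called related. Quasi-isomorphisms. A quasi-isomorphism $\mathcal Q:\mathcal C\to\tilde{\mathcal C}$ is a field isomorphism $\mathcal Q:\mathcal F_{\mathcal C}\to\mathcal F_{\tilde{\mathcal C}}$ such that for every extended marked cluster $\mathbf x$ with related extended cluster $\tilde{\mathbf x}$ there are integers $\lambda_{ij}$ ($i\in[1,N+M]$, $j\in\mathcal I(\kappa)$) with $\mathcal Q(x_i)=\tilde x_{\kappa(i)}\prod_{j\in\mathcal I(\kappa)}\tilde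 x_{\kappa(j)}^{\lambda_{ij}}$ for $i\notin\mathcal I(\kappa)$ and $\mathcal Q(x_i)=\prod_{j\in\mathcal I(\kappa)}\tilde x_{\kappa(j)}^{\lambda_{ij}}$ for $i\in\mathcal I(\kappa)$. If $\mathcal C,\tilde{\mathcal C}$ are cluster structures in normal (i.e. integrally closed) Noetherian domains $R,\tilde R$, then $\mathcal Q$ is birational if the marked variables $\mathbf x_0(\kappa)$, $\tilde{\mathbf x}_0(\kappa)$ are regular and the isomorphism $\mathcal Q:\mathcal A(\mathbf x_0)[\mathbf x_0(\kappa)^{\pm1}]\to\mathcal A(\tilde{\mathbf x}_0)[\tilde{\mathbf x}_0(\kappa)^{\pm1}]$ extends to an isomorphism of rings $R[\mathbf x_0(\kappa)^{\pm1}]\to\tilde R[\tilde{\mathbf x}_0(\kappa)^{\pm1}]$, where $[\,\cdot^{\pm1}]$ denotes localization at all the listed elements. All these notions apply equally to $(\mathcal C,\hat{\mathcal C},\kappa')$ and $\mathcal Q'$, with hats in place of tildes. A pair of birational quasi-isomorphisms $\mathcal Q:(\mathcal C,R)\to(\tilde{\mathcal C},\tilde R)$, $\mathcal Q':(\mathcal C,R)\to(\hat{\mathcal C},\hat R)$ (with the same initial extended seed of $\mathcal C$) is complementary if $\mathcal I(\kappa)\cap\mathcal I(\kappa')=\emptyset$. i-admissibility. A subset $A\subseteq\mathbf x_0$ of initial variables is i-admissible if: all variables in $A$ are regular and irreducible; for each cluster variable $x\in A$, its mutation $x'$ (from the initial extended seed) is regular and coprime with $x$. Likewise for subsets of $\tilde{\mathbf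 x}_0$ in $(\tilde{\mathcal C},\tilde R)$ and of $\hat{\mathbf x}_0$ in $(\hat{\mathcal C},\hat R)$.
   Formalization: The initial extended clusters are assumed algebraically independent over 𝕂 (not only over ℤ), so that each 𝒜̄_𝕂 embeds in the fraction field; without this the claim can fail when 𝕂 is transcendental over ℚ. *)

theory Defs
  imports Complex_Main "HOL-Library.Extended_Nat" "HOL-Computational_Algebra.Polynomial_Factorial"
begin

section \<open>Commutative algebra\<close>

text \<open>
  A ring \<open>R\<close> is a type \<open>'a\<close>, its fraction field is \<open>'a fract\<close>, and \<open>R\<close> sits in it as
  \<open>range to_fract\<close>. Subrings and subfields of a fraction field are sets.
\<close>

definition ring_hom_on :: "'a::ring_1 set \<Rightarrow> ('a \<Rightarrow> 'b::ring_1) \<Rightarrow> bool" where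
  "ring_hom_on A f \<longleftrightarrow> f 1 = 1 \<and>
     (\<forall>a\<in>A. \<forall>b\<in>A. f (a + b) = f a + f b \<and> f (a * b) = f a * f b)"

definition ring_iso_on :: "('a::ring_1 \<Rightarrow> 'b::ring_1) \<Rightarrow> 'a set \<Rightarrow> 'b set \<Rightarrow> bool" where
  "ring_iso_on f A B \<longleftrightarrow> ring_hom_on A f \<and> bij_betw f A B"

definition subring_set :: "'a::ring_1 set \<Rightarrow> bool" where
  "subring_set A \<longleftrightarrow> 1 \<in> A \<and> (\<forall>a\<in>A. \<forall>b\<in>A. a - b \<in> A \<and> a * b \<in> A)"

definition subfield_set :: "'a::field set \<Rightarrow> bool" where
  "subfield_set A \<longleftrightarrow> subring_set A \<and> (\<forall>a\<in>A. inverse a \<in> A)"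

text \<open>\<open>localize A S\<close> is \<open>A[S\<^sup>\<plusminus>\<^sup>1]\<close> inside an ambient field, for a subring \<open>A\<close> and nonzero
  \<open>S \<subseteq> A\<close>.\<close>

definition localize :: "'a::field set \<Rightarrow> 'a set \<Rightarrow> 'a set" where
  "localize A S = subring_set hull (A \<union> inverse ` S)"

definition ideal_set :: "'a::comm_ring_1 set \<Rightarrow> bool" where
  "ideal_set I \<longleftrightarrow> module.subspace (*) I"

definition prime_ideal :: "'a::comm_ring_1 set \<Rightarrow> bool" where
  "prime_ideal P \<longleftrightarrow> ideal_set P \<and> P \<noteq> UNIV \<and> (\<forall>a b. a * b \<in> P \<longrightarrow> a \<in> P \<or> b \<in> P)"

text \<open>The height: the supremum of the lengths \<open>n\<close> of chains \<open>p 0 \<subset> \<dots> \<subset> p n = P\<close> of prime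
  ideals.\<close>

definition ideal_height :: "'a::comm_ring_1 set \<Rightarrow> enat" where
  "ideal_height P = (SUP n \<in> {n. \<exists>p. (\<forall>i\<le>n. prime_ideal (p i)) \<and> (\<forall>i<n. p i \<subset> p (Suc i)) \<and> p n = P}.
     enat n)"

definition coprime_elems :: "'a::comm_ring_1 \<Rightarrow> 'a \<Rightarrow> bool" where
  "coprime_elems x y \<longleftrightarrow> \<not> (\<exists>P. prime_ideal P \<and> ideal_height P = 1 \<and> x \<in> P \<and> y \<in> P)"

definition noetherian :: "'a::comm_ring_1 itself \<Rightarrow> bool" where
  "noetherian _ \<longleftrightarrow> (\<forall>I::'a set. ideal_set I \<longrightarrow> (\<exists>S. finite S \<and> I = module.span (*) S))"

text \<open>Evaluation at \<open>x 1, \<dots>, x n\<close> is injective on polynomials with coefficients in \<open>'r\<close>, i.e. it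
  embeds \<open>'r[x\<^sub>1, \<dots>, x\<^sub>n]\<close> into \<open>'f\<close>; here \<open>\<phi>\<close> is the structure map of the \<open>'r\<close>-algebra \<open>'f\<close>, and
  \<open>E\<close> is the finite set of exponent vectors of a polynomial.\<close>

definition alg_indep :: "('r::comm_ring_1 \<Rightarrow> 'f::field) \<Rightarrow> nat \<Rightarrow> (nat \<Rightarrow> 'f) \<Rightarrow> bool" where
  "alg_indep \<phi> n x \<longleftrightarrow>
     (\<forall>E c. finite E \<and> E \<subseteq> {e::nat \<Rightarrow> nat. \<forall>i. i \<notin> {1..n} \<longrightarrow> e i = 0} \<and>
        (\<Sum>e\<in>E. \<phi> (c e) * (\<Prod>i=1..n. x i ^ e i)) = 0 \<longrightarrow> (\<forall>e\<in>E. c e = 0))"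


section \<open>Cluster structures\<close>

text \<open>Entries with indices outside \<open>[1, N + M]\<close> (and rows outside \<open>[1, N]\<close>) are irrelevant.\<close>

type_synonym 'f seed = "(nat \<Rightarrow> 'f) \<times> (nat \<Rightarrow> nat \<Rightarrow> int)"

record 'f cluster_structure =
  rank :: nat
  nfrozen :: nat
  init_seed :: "'f seed"

abbreviation nvars :: "('f, 'z) cluster_structure_scheme \<Rightarrow> nat" where
  "nvars C \<equiv> rank C + nfrozen C"

abbreviation init_cluster :: "('f, 'z) cluster_structure_scheme \<Rightarrow> nat \<Rightarrow> 'f" where
  "init_cluster C \<equiv> fst (init_seed C)"

definition skew_symmetrizable :: "nat \<Rightarrow> (nat \<Rightarrow> nat \<Rightarrow> int) \<Rightarrow> bool" where
  "skew_symmetrizable N B \<longleftrightarrow> (\<exists>d::nat \<Rightarrow> real. (\<forall>i\<in>{1..N}. d i > 0) \<and>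
     (\<forall>i\<in>{1..N}. \<forall>j\<in>{1..N}. d i * of_int (B i j) = - (d j * of_int (B j i))))"

text \<open>The elements generate a field of rational functions in \<open>N + M\<close> variables over \<open>\<rat>\<close> iff they are
  algebraically independent over \<open>\<int>\<close>.\<close>

definition extended_seed :: "nat \<Rightarrow> nat \<Rightarrow> 'f::field seed \<Rightarrow> bool" where
  "extended_seed N M \<Sigma> \<longleftrightarrow>
     alg_indep (of_int :: int \<Rightarrow> 'f) (N + M) (fst \<Sigma>) \<and> skew_symmetrizable N (snd \<Sigma>)"

definition mutate :: "('f::field, 'z) cluster_structure_scheme \<Rightarrow> nat \<Rightarrow> 'f seed \<Rightarrow> 'f seed" where
  "mutate C k \<Sigma> = (let x = fst \<Sigma>; B = snd \<Sigma> in
     (x(k := ((\<Prod>j | j \<in> {1..nvars C} \<and> B k j > 0. x j ^ nat (B k j)) +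
              (\<Prod>j | j \<in> {1..nvars C} \<and> B k j < 0. x j ^ nat (- B k j))) / x k),
      \<lambda>i j. if i = k \<or> j = k then - B i j
            else B i j + (\<bar>B i k\<bar> * B k j + B i k * \<bar>B k j\<bar>) div 2))"

definition mutate_seq :: "('f::field, 'z) cluster_structure_scheme \<Rightarrow> nat list \<Rightarrow> 'f seed" where
  "mutate_seq C ks = fold (mutate C) ks (init_seed C)"

definition seeds :: "('f::field, 'z) cluster_structure_scheme \<Rightarrow> 'f seed set" where
  "seeds C = {mutate_seq C ks | ks. set ks \<subseteq> {1..rank C}}"

definition ambient_field :: "('f::field, 'z) cluster_structure_scheme \<Rightarrow> 'f set" where
  "ambient_field C = subfield_set hull (init_cluster C ` {1..nvars C})"

definition poly_ring :: "('f::field, 'z) cluster_structure_scheme \<Rightarrow> (nat \<Rightarrow> 'f) \<Rightarrow> 'f set" where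
  "poly_ring C x = subring_set hull (x ` {1..nvars C})"

definition laurent_ring :: "('f::field, 'z) cluster_structure_scheme \<Rightarrow> (nat \<Rightarrow> 'f) \<Rightarrow> 'f set" where
  "laurent_ring C x = localize (poly_ring C x) (x ` {1..rank C})"

definition upper_cluster_algebra :: "('f::field, 'z) cluster_structure_scheme \<Rightarrow> 'f set" where
  "upper_cluster_algebra C = (\<Inter>\<Sigma>\<in>seeds C. laurent_ring C (fst \<Sigma>))"

text \<open>
  A cluster structure in a \<open>\<bbbK>\<close>-algebra \<open>R\<close> with structure map \<open>\<iota>\<close>, after identifying the ambient
  field with its image in \<open>Frac R\<close>. The last conjunct says that the embedding of \<open>\<int>[\<^bold>x\<^sub>0]\<close> induces an
  embedding of \<open>\<int>[\<^bold>x\<^sub>0] \<otimes> \<bbbK> = \<bbbK>[\<^bold>x\<^sub>0]\<close>; without it the upper cluster algebra over \<open>\<bbbK>\<close>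
  would not be a subset of \<open>Frac R\<close>.
\<close>

definition cluster_structure_in ::
    "('k::field_char_0 \<Rightarrow> 'a::idom) \<Rightarrow> ('a fract, 'z) cluster_structure_scheme \<Rightarrow> bool" where
  "cluster_structure_in \<iota> C \<longleftrightarrow>
     extended_seed (rank C) (nfrozen C) (init_seed C) \<and>
     alg_indep (\<lambda>c. to_fract (\<iota> c)) (nvars C) (init_cluster C)"

text \<open>
  The tensor product of the upper cluster algebra with \<open>\<bbbK>\<close>, as the \<open>\<bbbK>\<close>-span inside \<open>Frac R\<close>.
  The two agree because \<open>\<bbbK>\<close> and \<open>\<rat>(\<^bold>x\<^sub>0)\<close> are linearly disjoint over \<open>\<rat>\<close> when \<open>\<^bold>x\<^sub>0\<close> is
  algebraically independent over \<open>\<bbbK>\<close>.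
\<close>

definition upper_cluster_algebra_over ::
    "('k::field_char_0 \<Rightarrow> 'a::idom) \<Rightarrow> ('a fract, 'z) cluster_structure_scheme \<Rightarrow> 'a fract set" where
  "upper_cluster_algebra_over \<iota> C =
     module.span (\<lambda>c f. to_fract (\<iota> c) * f) (upper_cluster_algebra C)"

definition regular :: "'a::idom fract set \<Rightarrow> bool" where
  "regular X \<longleftrightarrow> X \<subseteq> range to_fract"

definition i_admissible ::
    "('a::idom fract, 'z) cluster_structure_scheme \<Rightarrow> 'a fract set \<Rightarrow> bool" where
  "i_admissible C A \<longleftrightarrow>
     A \<subseteq> init_cluster C ` {1..nvars C} \<and>
     (\<forall>x\<in>A. \<exists>a. x = to_fract a \<and> irreducible a) \<and>
     (\<forall>k\<in>{1..rank C}. init_cluster C k \<in> A \<longrightarrow>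
        (\<exists>a a'. init_cluster C k = to_fract a \<and>
                fst (mutate C k (init_seed C)) k = to_fract a' \<and> coprime_elems a' a))"


section \<open>Related triples and quasi-isomorphisms\<close>

definition related_triple ::
    "('f, 'y) cluster_structure_scheme \<Rightarrow> ('g, 'z) cluster_structure_scheme \<Rightarrow> (nat \<Rightarrow> nat) \<Rightarrow> bool" where
  "related_triple C C' \<kappa> \<longleftrightarrow>
     rank C' < rank C \<and> nvars C = nvars C' \<and>
     bij_betw \<kappa> {1..nvars C} {1..nvars C} \<and>
     \<kappa> ` {rank C + 1..nvars C} \<subseteq> {rank C' + 1..nvars C'}"

definition marked_target ::
    "('f, 'y) cluster_structure_scheme \<Rightarrow> ('g, 'z) cluster_structure_scheme \<Rightarrow> (nat \<Rightarrow> nat) \<Rightarrow> nat set" where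
  "marked_target C C' \<kappa> = {rank C' + 1..nvars C'} \<inter> \<kappa> ` {1..rank C}"

definition marked_source ::
    "('f, 'y) cluster_structure_scheme \<Rightarrow> ('g, 'z) cluster_structure_scheme \<Rightarrow> (nat \<Rightarrow> nat) \<Rightarrow> nat set" where
  "marked_source C C' \<kappa> = {i \<in> {1..nvars C}. \<kappa> i \<in> marked_target C C' \<kappa>}"

definition related_clusters ::
    "('f::field, 'y) cluster_structure_scheme \<Rightarrow> ('g::field, 'z) cluster_structure_scheme \<Rightarrow>
     (nat \<Rightarrow> nat) \<Rightarrow> (nat \<Rightarrow> 'f) \<Rightarrow> (nat \<Rightarrow> 'g) \<Rightarrow> bool" where
  "related_clusters C C' \<kappa> x x' \<longleftrightarrow>
     (\<exists>ks. set ks \<subseteq> {1..rank C} - marked_source C C' \<kappa> \<and>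
           x = fst (mutate_seq C ks) \<and> x' = fst (mutate_seq C' (map \<kappa> ks)))"

definition quasi_isomorphism ::
    "('f::field, 'y) cluster_structure_scheme \<Rightarrow> ('g::field, 'z) cluster_structure_scheme \<Rightarrow>
     (nat \<Rightarrow> nat) \<Rightarrow> ('f \<Rightarrow> 'g) \<Rightarrow> bool" where
  "quasi_isomorphism C C' \<kappa> Q \<longleftrightarrow>
     ring_iso_on Q (ambient_field C) (ambient_field C') \<and>
     (\<forall>x x'. related_clusters C C' \<kappa> x x' \<longrightarrow>
        (\<exists>\<mu>::nat \<Rightarrow> nat \<Rightarrow> int. \<forall>i\<in>{1..nvars C}.
           Q (x i) = (if i \<in> marked_source C C' \<kappa> then 1 else x' (\<kappa> i)) *
                     (\<Prod>j\<in>marked_source C C' \<kappa>. x' (\<kappa> j) powi \<mu> i j)))"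

definition birational ::
    "('a::idom fract, 'y) cluster_structure_scheme \<Rightarrow> ('b::idom fract, 'z) cluster_structure_scheme \<Rightarrow>
     (nat \<Rightarrow> nat) \<Rightarrow> ('a fract \<Rightarrow> 'b fract) \<Rightarrow> bool" where
  "birational C C' \<kappa> Q \<longleftrightarrow> (let
       m = init_cluster C ` marked_source C C' \<kappa>;
       m' = init_cluster C' ` marked_target C C' \<kappa>;
       A = localize (poly_ring C (init_cluster C)) m;
       R = localize (range to_fract) m;
       R' = localize (range to_fract) m'
     in regular m \<and> regular m' \<and>
        A \<subseteq> R \<and> (\<exists>\<Phi>. ring_iso_on \<Phi> R R' \<and> (\<forall>a\<in>A. \<Phi> a = Q a)))"

end

theory Submission
  imports Defs
begin

text \<open>
  Everything is checked one prime at a time: an element of \<open>Frac R\<close> lies in \<open>R\<close> iff it lies in the local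
  ring \<open>loc_at p\<close> of every prime element \<open>p\<close>. If the initial cluster is i-admissible, the Laurent ring
  of the initial seed lies in \<open>loc_at p\<close> unless \<open>p\<close> is associated to some cluster variable \<open>x\<^sub>k\<close>, and
  then the Laurent ring of the seed mutated at \<open>k\<close> does; this settles the inclusions.

  For the i-admissibility of \<open>\<^bold>x\<^sub>0\<close>, let \<open>S\<close> and \<open>S'\<close> be the localizations of \<open>R\<close> at the marked variables
  of the two triples. An unmarked \<open>x\<^sub>i\<close> corresponds to a prime of the target ring up to units, so it is
  a prime of \<open>S\<close>. The isomorphism bounds the rank of the units of \<open>S\<close> by the number of marked
  variables. Each variable marked for \<open>S\<close> has exactly one prime factor that is not a unit in \<open>S'\<close>;
  these factors already exhaust the rank, so no prime is a unit in both \<open>S\<close> and \<open>S'\<close>, and the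
  factors of \<open>x\<^sub>i\<close> that become invertible in \<open>S\<close> are trivial. Finally, \<open>x\<^sub>k'\<close> lies in \<open>S\<close> and in
  \<open>R[1/x\<^sub>k]\<close>, hence in \<open>R\<close>, and a divisibility \<open>x\<^sub>k dvd x\<^sub>k'\<close> would carry over to the target ring.
\<close>


section \<open>Subrings of a field\<close>

lemma subring_setD:
  assumes "subring_set A"
  shows subring_set_1: "1 \<in> A"
    and subring_set_0: "0 \<in> A"
    and subring_set_diff: "\<And>a b. a \<in> A \<Longrightarrow> b \<in> A \<Longrightarrow> a - b \<in> A"
    and subring_set_mult: "\<And>a b. a \<in> A \<Longrightarrow> b \<in> A \<Longrightarrow> a * b \<in> A"
    and subring_set_add: "\<And>a b. a \<in> A \<Longrightarrow> b \<in> A \<Longrightarrow> a + b \<in> A"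
proof -
  show one: "1 \<in> A" and diff: "\<And>a b. a \<in> A \<Longrightarrow> b \<in> A \<Longrightarrow> a - b \<in> A"
    and "\<And>a b. a \<in> A \<Longrightarrow> b \<in> A \<Longrightarrow> a * b \<in> A"
    using assms by (auto simp: subring_set_def)
  show zero: "0 \<in> A" using diff[OF one one] by simp
  show "a + b \<in> A" if "a \<in> A" "b \<in> A" for a b
    using diff[OF that(1) diff[OF zero that(2)]] by simp
qed

lemma subring_set_power:
  assumes "subring_set A" "a \<in> A" shows "a ^ n \<in> A"
  by (induction n) (use assms in \<open>auto intro: subring_set_1 subring_set_mult\<close>)

lemma subring_set_prod:
  fixes f :: "'i \<Rightarrow> 'a::comm_ring_1"
  assumes "subring_set A" "\<And>i. i \<in> I \<Longrightarrow> f i \<in> A" shows "prod f I \<in> A"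
  using assms(2)
  by (induction I rule: infinite_finite_induct)
    (auto intro: subring_set_1[OF assms(1)] subring_set_mult[OF assms(1)])

lemma subring_set_hull: "subring_set (subring_set hull A)"
  by (rule hull_in) (auto simp: subring_set_def)

lemma subfield_set_hull: "subfield_set (subfield_set hull A)"
  by (rule hull_in) (auto simp: subfield_set_def subring_set_def)

lemma subring_set_localize: "subring_set (localize A X)"
  unfolding localize_def by (rule subring_set_hull)

lemma localize_superset: "A \<subseteq> localize A X"
  unfolding localize_def by (meson hull_subset le_sup_iff)

lemma inverse_in_localize: "x \<in> X \<Longrightarrow> inverse x \<in> localize A X"
  unfolding localize_def by (simp add: hull_inc)

lemma localize_minimal:
  "subring_set T \<Longrightarrow> A \<subseteq> T \<Longrightarrow> (\<And>x. x \<in> X \<Longrightarrow> inverse x \<in> T) \<Longrightarrow> localize A X \<subseteq> T"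
  unfolding localize_def by (rule hull_minimal) auto

text \<open>The units of a subring are tested in the ambient field. Since
  \<open>inverse 0 = 0\<close>, zero has to be excluded explicitly.\<close>

definition unit_in :: "'a::field set \<Rightarrow> 'a \<Rightarrow> bool" where
  "unit_in S f \<longleftrightarrow> f \<in> S \<and> inverse f \<in> S \<and> f \<noteq> 0"

lemma unit_in_mult: "subring_set S \<Longrightarrow> unit_in S f \<Longrightarrow> unit_in S g \<Longrightarrow> unit_in S (f * g)"
  by (auto simp: unit_in_def intro: subring_set_mult)

lemma unit_in_inverse: "unit_in S f \<Longrightarrow> unit_in S (inverse f)"
  by (auto simp: unit_in_def)

lemma unit_in_1: "subring_set S \<Longrightarrow> unit_in S 1"
  by (auto simp: unit_in_def subring_set_1)

lemma unit_in_power: "subring_set S \<Longrightarrow> unit_in S f \<Longrightarrow> unit_in S (f ^ n)"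
  by (induction n) (auto intro: unit_in_1 unit_in_mult)

lemma unit_in_power_int: "subring_set S \<Longrightarrow> unit_in S f \<Longrightarrow> unit_in S (f powi n)"
  by (auto simp: power_int_def intro: unit_in_power unit_in_inverse)

lemma unit_in_prod:
  assumes "subring_set S" "\<And>i. i \<in> I \<Longrightarrow> unit_in S (f i)" shows "unit_in S (prod f I)"
  using assms(2)
  by (induction I rule: infinite_finite_induct)
    (auto intro: unit_in_1[OF assms(1)] unit_in_mult[OF assms(1)])

lemma unit_in_mult_left:
  assumes "subring_set S" "f \<in> S" "g \<in> S" "unit_in S (f * g)"
  shows "unit_in S f"
proof -
  have "inverse f = g * inverse (f * g)" using assms(4) by (auto simp: unit_in_def field_simps)
  also have "\<dots> \<in> S"
    using assms(4) by (intro subring_set_mult[OF assms(1,3)]) (simp add: unit_in_def)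
  finally show ?thesis using assms by (auto simp: unit_in_def)
qed


section \<open>Localizations of a factorial domain inside its fraction field\<close>

lemma subring_set_range_to_fract: "subring_set (range to_fract)"
proof -
  have "1 \<in> range to_fract" by (metis rangeI to_fract_1)
  moreover have "to_fract a - to_fract b \<in> range to_fract"
    "to_fract a * to_fract b \<in> range to_fract" for a b :: 'a
    by (metis rangeI to_fract_diff, metis rangeI to_fract_mult)
  ultimately show ?thesis unfolding subring_set_def by blast
qed

lemma unit_in_to_fract_dvd:
  fixes a b :: "'a::idom"
  assumes "subring_set S" "range to_fract \<subseteq> S" "unit_in S (to_fract b)" "a dvd b"
  shows "unit_in S (to_fract a)"
proof -
  obtain c where "b = a * c" using assms(4) by blast
  then show ?thesis
    using unit_in_mult_left[OF assms(1), of "to_fract a" "to_fract c"] assms by auto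
qed

text \<open>For a prime \<open>p\<close> this is the localization of R at the prime ideal (p). The
  condition on \<open>b\<close> also excludes \<open>b = 0\<close>, because
  \<open>p dvd 0\<close>.\<close>

definition loc_at :: "'a::idom \<Rightarrow> 'a fract set" where
  "loc_at p = {to_fract a / to_fract b | a b. \<not> p dvd b}"

lemma loc_atI: "\<not> p dvd b \<Longrightarrow> to_fract a / to_fract b \<in> loc_at p"
  by (auto simp: loc_at_def)

lemma range_to_fract_subset_loc_at: "prime_elem p \<Longrightarrow> range to_fract \<subseteq> loc_at p"
  using loc_atI[of p 1] prime_elem_not_unit[of p] by auto

lemma inverse_in_loc_at: "\<not> p dvd b \<Longrightarrow> inverse (to_fract b) \<in> loc_at p"
  using loc_atI[of p b 1] by (simp add: inverse_eq_divide)

lemma subring_set_loc_at: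
  assumes p: "prime_elem p"
  shows "subring_set (loc_at p)"
proof -
  have "to_fract a / to_fract b - to_fract c / to_fract d \<in> loc_at p \<and>
        to_fract a / to_fract b * (to_fract c / to_fract d) \<in> loc_at p"
    if "\<not> p dvd b" "\<not> p dvd d" for a b c d
  proof -
    have bd: "\<not> p dvd b * d" using that p by (simp add: prime_elem_dvd_mult_iff)
    have "b \<noteq> 0" "d \<noteq> 0" using that by auto
    then have "to_fract a / to_fract b - to_fract c / to_fract d =
        to_fract (a * d - c * b) / to_fract (b * d)"
      by (simp add: diff_frac_eq)
    moreover have "to_fract a / to_fract b * (to_fract c / to_fract d) =
        to_fract (a * c) / to_fract (b * d)" by simp
    ultimately show ?thesis by (simp only: loc_atI[OF bd])
  qed
  moreover have "1 \<in> loc_at p"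
    using subsetD[OF range_to_fract_subset_loc_at[OF p] rangeI[of _ 1]] by simp
  moreover have "\<exists>a b. f = to_fract a / to_fract b \<and> \<not> p dvd b" if "f \<in> loc_at p" for f
    using that by (simp add: loc_at_def)
  ultimately show ?thesis unfolding subring_set_def by metis
qed

text \<open>A factorial domain is the intersection of its local rings at prime elements. The
  induction removes one prime factor of the denominator at a time: membership in
  \<open>loc_at p\<close> forces \<open>p\<close> to divide the numerator, so it cancels.\<close>

lemma to_fract_in_range_if_loc_at:
  fixes a b :: "'a::{idom, factorial_semiring}"
  assumes "b \<noteq> 0" "\<And>p. prime_elem p \<Longrightarrow> to_fract a / to_fract b \<in> loc_at p"
  shows "to_fract a / to_fract b \<in> range to_fract"
  using assms
proof (induction b arbitrary: a rule: prime_divisors_induct)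
  case (unit b)
  then obtain c where "1 = b * c" by blast
  then have "to_fract b * to_fract c = 1" by (metis to_fract_1 to_fract_mult)
  then have "to_fract a / to_fract b = to_fract (a * c)"
    by (simp add: field_simps unit)
  then show ?case by (simp only: rangeI)
next
  case (factor p b)
  have p: "prime_elem p" using factor by auto
  obtain c d where "to_fract a / to_fract (p * b) = to_fract c / to_fract d" "\<not> p dvd d"
    using factor(4)[OF p] by (auto simp: loc_at_def)
  moreover from this have "d \<noteq> 0" by auto
  ultimately have "to_fract (a * d) = to_fract (c * (p * b))"
    using factor by (auto simp: field_simps)
  then have "a * d = c * (p * b)" by (simp only: to_fract_eq_iff)
  then have "p dvd a * d" by simp
  then have "p dvd a" using p \<open>\<not> p dvd d\<close> by (simp add: prime_elem_dvd_mult_iff)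
  then obtain a' where "a = p * a'" by blast
  then have "to_fract a / to_fract (p * b) = to_fract a' / to_fract b"
    using p by (auto simp: field_simps)
  then show ?case using factor by auto
qed auto

lemma fract_cases:
  obtains a b where "f = to_fract a / to_fract b" "b \<noteq> 0"
  by (cases f) (auto simp: Fract_conv_to_fract)

lemma range_to_fract_if_loc_at:
  fixes f :: "'a::{idom, factorial_semiring} fract"
  assumes "\<And>p. prime_elem p \<Longrightarrow> f \<in> loc_at p"
  shows "f \<in> range to_fract"
  by (cases f rule: fract_cases) (use assms to_fract_in_range_if_loc_at in blast)

lemma irreducible_dvd_irreducible:
  fixes p q :: "'a::{idom, factorial_semiring}"
  assumes "irreducible p" "irreducible q" "p dvd q"
  obtains u where "u dvd 1" "q = u * p"
proof -
  obtain u where u: "q = p * u" using assms(3) by blast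
  then have "u dvd 1" using irreducibleD[OF assms(2) u] irreducible_not_unit[OF assms(1)] by blast
  then show thesis using that u by (simp add: mult.commute)
qed

text \<open>The inverted elements are given in R rather than in Frac R, so that divisibility applies
  to them. Finiteness of \<open>X\<close> ensures that only finitely many primes become
  units.\<close>

locale localization =
  fixes X :: "'a::{idom, factorial_semiring} set" and S :: "'a fract set"
  assumes S_eq: "S = localize (range to_fract) (to_fract ` X)"
    and finite_X: "finite X"
    and zero_notin_X: "0 \<notin> X"
begin

lemma subring_S: "subring_set S"
  unfolding S_eq by (rule subring_set_localize)

lemma range_subset_S: "range to_fract \<subseteq> S"
  unfolding S_eq by (rule localize_superset)

lemma to_fract_in_S [simp]: "to_fract a \<in> S"
  using range_subset_S by auto

lemma unit_in_generator: "a \<in> X \<Longrightarrow> unit_in S (to_fract a)"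
  using zero_notin_X inverse_in_localize[of "to_fract a"]
    localize_superset[of "range to_fract" "to_fract ` X"]
  unfolding unit_in_def S_eq by auto

lemma unit_in_dvd: "unit_in S (to_fract b) \<Longrightarrow> a dvd b \<Longrightarrow> unit_in S (to_fract a)"
  by (rule unit_in_to_fract_dvd[OF subring_S range_subset_S])

lemma unit_in_unit: "a dvd 1 \<Longrightarrow> unit_in S (to_fract a)"
  by (rule unit_in_dvd[of 1]) (auto simp: unit_in_1 subring_S)

text \<open>The denominators are described as the elements of R that are units of \<open>S\<close>,
  not as products of generators. Fractions of this kind already form a subring containing R and the
  inverted generators.\<close>

lemma S_fraction:
  assumes "f \<in> S"
  obtains r m where "f = to_fract r / to_fract m" "unit_in S (to_fract m)"
proof -
  let ?T = "{to_fract r / to_fract m | r m. unit_in S (to_fract m)}"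
  have "localize (range to_fract) (to_fract ` X) \<subseteq> ?T"
  proof (rule localize_minimal)
    have "to_fract a / to_fract b - to_fract c / to_fract d \<in> ?T \<and>
          to_fract a / to_fract b * (to_fract c / to_fract d) \<in> ?T"
      if "unit_in S (to_fract b)" "unit_in S (to_fract d)" for a b c d
    proof -
      have bd: "unit_in S (to_fract (b * d))" using that by (simp add: unit_in_mult subring_S)
      have "b \<noteq> 0" "d \<noteq> 0" using that by (auto simp: unit_in_def)
      then have "to_fract a / to_fract b - to_fract c / to_fract d =
          to_fract (a * d - c * b) / to_fract (b * d)"
        by (simp add: diff_frac_eq)
      moreover have "to_fract a / to_fract b * (to_fract c / to_fract d) =
          to_fract (a * c) / to_fract (b * d)" by simp
      ultimately show ?thesis using bd by blast
    qed
    moreover have "1 \<in> ?T" using unit_in_1[OF subring_S] by (auto intro!: exI[of _ 1])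
    ultimately show "subring_set ?T" unfolding subring_set_def by blast
    have "to_fract a = to_fract a / to_fract 1" "unit_in S (to_fract 1)" for a
      by (simp_all add: unit_in_1 subring_S)
    then show "range to_fract \<subseteq> ?T" by blast
    show "inverse x \<in> ?T" if x: "x \<in> to_fract ` X" for x
    proof -
      obtain a where "x = to_fract a" "a \<in> X" using x by blast
      then have "inverse x = to_fract 1 / to_fract a" "unit_in S (to_fract a)"
        by (simp_all add: inverse_eq_divide unit_in_generator)
      then show ?thesis by blast
    qed
  qed
  then show thesis using assms that unfolding S_eq by blast
qed

lemma S_subset_loc_at:
  assumes "prime_elem p" "\<And>a. a \<in> X \<Longrightarrow> \<not> p dvd a"
  shows "S \<subseteq> loc_at p"
  unfolding S_eq
  by (rule localize_minimal)
    (use assms in \<open>auto intro: subring_set_loc_at inverse_in_loc_at range_to_fract_subset_loc_at[THEN subsetD]\<close>)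

text \<open>Otherwise \<open>S\<close> would lie in \<open>loc_at p\<close>, where \<open>p\<close>
  is not invertible.\<close>

lemma prime_unit_in_dvd_generator:
  assumes "prime_elem p" "unit_in S (to_fract p)"
  obtains a where "a \<in> X" "p dvd a"
proof -
  have False if "\<And>a. a \<in> X \<Longrightarrow> \<not> p dvd a"
  proof -
    have "inverse (to_fract p) \<in> loc_at p"
      using S_subset_loc_at[OF assms(1) that] assms(2) by (auto simp: unit_in_def)
    then obtain a b where ab: "inverse (to_fract p) = to_fract a / to_fract b" "\<not> p dvd b"
      by (auto simp: loc_at_def)
    have "b \<noteq> 0" "p \<noteq> 0" using ab assms(1) by auto
    then have "to_fract b = to_fract (a * p)" using ab(1) by (auto simp: field_simps)
    then have "b = a * p" by (simp only: to_fract_eq_iff)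
    then show False using ab(2) by simp
  qed
  then show thesis using that by blast
qed

lemma finite_prime_units: "finite {p. prime p \<and> unit_in S (to_fract p)}"
proof (rule finite_subset)
  show "{p. prime p \<and> unit_in S (to_fract p)} \<subseteq> (\<Union>a\<in>X. {p. prime p \<and> p dvd a})"
  proof
    fix p assume "p \<in> {p. prime p \<and> unit_in S (to_fract p)}"
    then show "p \<in> (\<Union>a\<in>X. {p. prime p \<and> p dvd a})"
      using prime_unit_in_dvd_generator[of p] by blast
  qed
  show "finite (\<Union>a\<in>X. {p. prime p \<and> p dvd a})"
    using finite_X zero_notin_X by (intro finite_UN_I finite_prime_divisors) auto
qed

text \<open>Writing \<open>f\<close> as a fraction brings in a denominator that is a unit of
  \<open>S\<close>; \<open>t\<close> cannot divide it, so \<open>t\<close> divides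
  \<open>s\<close>.\<close>

lemma dvd_if_dvd_in_S:
  assumes t: "prime_elem t" "\<not> unit_in S (to_fract t)"
    and f: "f \<in> S" "to_fract s = to_fract t * f"
  shows "t dvd s"
proof -
  obtain r m where rm: "f = to_fract r / to_fract m" "unit_in S (to_fract m)"
    using S_fraction f(1) by blast
  have "to_fract (s * m) = to_fract (t * r)"
    using rm f(2) by (auto simp: unit_in_def field_simps)
  then have "s * m = t * r" by (simp only: to_fract_eq_iff)
  then have "t dvd s * m" by simp
  moreover have "\<not> t dvd m" using t(2) rm(2) unit_in_dvd by blast
  ultimately show ?thesis using t(1) by (simp add: prime_elem_dvd_mult_iff)
qed

text \<open>A prime of R remains irreducible in \<open>S\<close> unless it becomes a unit. After
  clearing denominators, \<open>t\<close> divides one numerator, and the other numerator then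
  divides a unit of \<open>S\<close>.\<close>

lemma prime_elem_mult_in_S:
  assumes t: "prime_elem t" "\<not> unit_in S (to_fract t)"
    and fg: "f \<in> S" "g \<in> S" "to_fract t = f * g"
  shows "unit_in S f \<or> unit_in S g"
proof -
  \<comment> \<open>Cancelling \<open>t\<close> leaves \<open>s\<close> as a divisor of
    \<open>w\<close>.\<close>
  have *: "unit_in S (to_fract s)"
    if r: "t dvd r" "r * s = t * w" and w: "unit_in S (to_fract w)" for r s w
  proof -
    obtain r' where "r = t * r'" using r(1) by blast
    then have "w = s * r'" using r(2) t(1) by (auto simp: mult_ac)
    then show ?thesis using unit_in_dvd[OF w] by simp
  qed
  obtain r m where rm: "f = to_fract r / to_fract m" "unit_in S (to_fract m)"
    using S_fraction fg(1) by blast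
  obtain s n where sn: "g = to_fract s / to_fract n" "unit_in S (to_fract n)"
    using S_fraction fg(2) by blast
  have mn: "unit_in S (to_fract (m * n))" using rm sn by (simp add: unit_in_mult subring_S)
  have "to_fract (r * s) = to_fract (t * (m * n))"
    using rm sn fg(3) by (auto simp: unit_in_def field_simps)
  then have eq: "r * s = t * (m * n)" by (simp only: to_fract_eq_iff)
  then have "t dvd r * s" by simp
  then have "t dvd r \<or> t dvd s" using t(1) by (simp add: prime_elem_dvd_mult_iff)
  then have "unit_in S (to_fract s) \<or> unit_in S (to_fract r)"
    using *[OF _ eq mn] *[of s r, OF _ _ mn] eq by (auto simp: mult.commute)
  then show ?thesis
    using rm sn unit_in_mult[OF subring_S _ unit_in_inverse] by (auto simp: divide_inverse)
qed

end


section \<open>Height-one primes of a factorial domain\<close>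

lemma ideal_set_iff:
  "ideal_set I \<longleftrightarrow> 0 \<in> I \<and> (\<forall>x\<in>I. \<forall>y\<in>I. x + y \<in> I) \<and> (\<forall>c. \<forall>x\<in>I. c * x \<in> I)"
proof -
  have "module ((*) :: 'a::comm_ring_1 \<Rightarrow> _)" by unfold_locales (auto simp: algebra_simps)
  from module.subspace_def[OF this] show ?thesis by (simp add: ideal_set_def)
qed

lemma prime_ideal_multiples:
  assumes "prime_elem (p::'a::idom)" shows "prime_ideal {x. p dvd x}"
proof -
  have "1 \<notin> {x. p dvd x}" using prime_elem_not_unit[OF assms] by simp
  then have "{x. p dvd x} \<noteq> UNIV" by blast
  then show ?thesis
    using assms by (simp add: prime_ideal_def ideal_set_iff prime_elem_dvd_mult_iff)
qed
lemma prime_ideal_zero: "prime_ideal {0::'a::idom}"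
proof -
  have "(1::'a) \<notin> {0}" by simp
  then have "{0::'a} \<noteq> UNIV" by blast
  then show ?thesis by (simp add: prime_ideal_def ideal_set_iff)
qed

text \<open>A prime ideal that contains a product of primes contains one of the factors.\<close>

lemma prime_ideal_has_prime_elem:
  fixes x :: "'a::{idom, factorial_semiring}"
  assumes H: "prime_ideal H" and "x \<in> H" "x \<noteq> 0"
  shows "\<exists>q\<in>H. prime_elem q"
  using assms(2,3)
proof (induction x rule: prime_divisors_induct)
  case (unit x)
  have mult: "c * y \<in> H" if "y \<in> H" for c y
    using H that by (simp add: prime_ideal_def ideal_set_iff)
  obtain c where c: "1 = x * c" using unit(1) by blast
  have "y \<in> H" for y
  proof -
    have "y * c * x = y" using c by (metis mult.assoc mult.commute mult_1_right)
    then show ?thesis using mult[OF unit(2), of "y * c"] by (simp only:)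
  qed
  then have "H = UNIV" by blast
  then show ?case using H by (simp add: prime_ideal_def)
next
  case (factor p x)
  then have "p \<in> H \<or> x \<in> H" "x \<noteq> 0" using H unfolding prime_ideal_def by auto
  then show ?case using factor by blast
qed simp

text \<open>A nonzero element of \<open>H\<close> would give a prime \<open>q\<close> in
  \<open>H\<close> divisible by \<open>p\<close>. The two are then associated, and \<open>H\<close>
  is all of (p).\<close>

lemma prime_ideal_below_multiples:
  fixes p :: "'a::{idom, factorial_semiring}"
  assumes p: "prime_elem p" and H: "prime_ideal H" "H \<subset> {x. p dvd x}"
  shows "H = {0}"
proof -
  have ideal: "ideal_set H" using H(1) by (simp add: prime_ideal_def)
  have "x = 0" if x: "x \<in> H" for x
  proof (rule ccontr)
    assume "x \<noteq> 0"
    then obtain q where q: "q \<in> H" "prime_elem q" using prime_ideal_has_prime_elem[OF H(1) x] by blast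
    then have "p dvd q" using H(2) by blast
    then obtain u where u: "u dvd 1" "q = u * p"
      using irreducible_dvd_irreducible[of p q] p q(2) by (auto simp: prime_elem_iff_irreducible)
    from u(1) obtain v where v: "1 = u * v" by blast
    have "{x. p dvd x} \<subseteq> H"
    proof
      fix x assume "x \<in> {x. p dvd x}"
      then obtain d where d: "x = p * d" by blast
      have "(d * v) * q = (u * v) * (p * d)" unfolding u(2) by (simp only: mult_ac)
      also have "\<dots> = x" by (simp only: v[symmetric] mult_1_left d)
      finally have "x = (d * v) * q" by (rule sym)
      then show "x \<in> H" using ideal q(1) by (simp only: ideal_set_iff)
    qed
    then show False using H(2) by blast
  qed
  moreover have "0 \<in> H" using ideal by (simp add: ideal_set_iff)
  ultimately show ?thesis by auto
qed

lemma ideal_height_ge: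
  assumes "\<And>i. i \<le> n \<Longrightarrow> prime_ideal (p i)" "\<And>i. i < n \<Longrightarrow> p i \<subset> p (Suc i)" "p n = P"
  shows "enat n \<le> ideal_height P"
proof -
  have "n \<in> {n. \<exists>p. (\<forall>i\<le>n. prime_ideal (p i)) \<and> (\<forall>i<n. p i \<subset> p (Suc i)) \<and> p n = P}"
    using assms by (intro CollectI exI[of _ p]) simp
  then show ?thesis unfolding ideal_height_def by (rule SUP_upper)
qed

lemma zero_psubset_multiples:
  assumes "prime_elem (p::'a::idom)" shows "{0} \<subset> {x. p dvd x}"
proof (rule psubsetI)
  have "p \<in> {x. p dvd x}" "p \<notin> {0}" using assms by simp_all
  then show "{0} \<noteq> {x. p dvd x}" by metis
qed simp

text \<open>The chain from \<open>{0}\<close> to (p) bounds the height from below. In a longer chain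
  the member just under (p) would be \<open>{0}\<close> by
  \<open>prime_ideal_below_multiples\<close>, leaving no room for a further one.\<close>

lemma ideal_height_multiples:
  fixes p :: "'a::{idom, factorial_semiring}"
  assumes p: "prime_elem p"
  shows "ideal_height {x. p dvd x} = 1"
proof (rule antisym)
  have "enat n \<le> 1"
    if chain: "n \<in> {n. \<exists>P. (\<forall>i\<le>n. prime_ideal (P i)) \<and> (\<forall>i<n. P i \<subset> P (Suc i)) \<and> P n = {x. p dvd x}}"
    for n
  proof (rule ccontr)
    obtain P where P: "\<And>i. i \<le> n \<Longrightarrow> prime_ideal (P i)" "\<And>i. i < n \<Longrightarrow> P i \<subset> P (Suc i)"
      "P n = {x. p dvd x}"
      using chain by blast
    assume "\<not> enat n \<le> 1"
    then have "2 \<le> n" by (simp add: one_enat_def)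
    then obtain m where m: "n = Suc (Suc m)" by (metis add_2_eq_Suc le_Suc_ex)
    have "P (Suc m) = {0}"
      using prime_ideal_below_multiples[OF p P(1)[of "Suc m"]] P(2)[of "Suc m"] P(3) by (simp add: m)
    moreover have "P m \<subset> P (Suc m)" by (rule P(2)) (simp add: m)
    \<comment> \<open>Only the empty set lies strictly below \<open>{0}\<close>, whereas every ideal
      contains 0.\<close>
    ultimately have "P m = {}" by (metis psubset_imp_subset psubset_eq subset_singletonD)
    moreover have "prime_ideal (P m)" by (rule P(1)) (simp add: m)
    then have "0 \<in> P m" by (simp add: prime_ideal_def ideal_set_iff)
    ultimately show False by simp
  qed
  then show "ideal_height {x. p dvd x} \<le> 1"
    unfolding ideal_height_def by (rule SUP_least)
  note less = zero_psubset_multiples[OF p]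
  have "enat 1 \<le> ideal_height {x. p dvd x}"
    by (rule ideal_height_ge[where p = "\<lambda>i. if i = 0 then {0} else {x. p dvd x}"])
      (use prime_ideal_multiples[OF p] less in \<open>simp_all add: prime_ideal_zero\<close>)
  then show "1 \<le> ideal_height {x. p dvd x}" by (simp add: one_enat_def)
qed

text \<open>If the inclusion of (p) in \<open>H\<close> were strict, prepending \<open>{0}\<close>
  would give a chain of length 2.\<close>

lemma height_one_prime_eq_multiples:
  fixes p :: "'a::{idom, factorial_semiring}"
  assumes p: "prime_elem p" and H: "prime_ideal H" "ideal_height H = 1" "p \<in> H"
  shows "H = {x. p dvd x}"
proof (rule ccontr)
  assume "H \<noteq> {x. p dvd x}"
  moreover have "{x. p dvd x} \<subseteq> H"
  proof
    fix x assume "x \<in> {x. p dvd x}"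
    then obtain c where c: "x = p * c" by blast
    have "c * p \<in> H" using H(1,3) by (simp add: prime_ideal_def ideal_set_iff)
    then show "x \<in> H" unfolding c by (simp only: mult.commute)
  qed
  ultimately have less1: "{x. p dvd x} \<subset> H" by blast
  note less0 = zero_psubset_multiples[OF p]
  have "enat 2 \<le> ideal_height H"
    by (rule ideal_height_ge[where p = "\<lambda>i. if i = 0 then {0} else if i = 1 then {x. p dvd x} else H"])
      (use prime_ideal_multiples[OF p] H(1) less0 less1 in \<open>auto simp: prime_ideal_zero less_2_cases_iff\<close>)
  then show False using H(2) by (simp add: one_enat_def)
qed

text \<open>The only height-one prime containing \<open>p\<close> is (p). This turns coprimality
  with an irreducible variable into non-divisibility.\<close>

lemma coprime_elems_prime_elem_iff:
  fixes p :: "'a::{idom, factorial_semiring}"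
  assumes p: "prime_elem p"
  shows "coprime_elems x p \<longleftrightarrow> \<not> p dvd x"
proof
  assume "coprime_elems x p"
  then show "\<not> p dvd x"
    unfolding coprime_elems_def
    using prime_ideal_multiples[OF p] ideal_height_multiples[OF p] by auto
next
  assume x: "\<not> p dvd x"
  show "coprime_elems x p"
    unfolding coprime_elems_def
  proof (rule notI, elim exE conjE)
    fix P assume P: "prime_ideal P" "ideal_height P = 1" "x \<in> P" "p \<in> P"
    show False using height_one_prime_eq_multiples[OF p P(1,2,4)] P(3) x by blast
  qed
qed


section \<open>The starfish lemma\<close>

lemma ring_hom_on_UNIV:
  assumes "ring_hom_on UNIV f"
  shows "f 0 = 0" "f 1 = 1" "f (a + b) = f a + f b" "f (a * b) = f a * f b" "f (- a) = - f a"
    "f (a - b) = f a - f b"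
proof -
  show one: "f 1 = 1" and add: "f (a + b) = f a + f b" and "f (a * b) = f a * f b" for a b
    using assms by (auto simp: ring_hom_on_def)
  show zero: "f 0 = 0" using add[of 0 0] by simp
  show minus: "f (- a) = - f a" for a using add[of a "- a"] zero by (simp add: eq_neg_iff_add_eq_0 add.commute)
  show "f (a - b) = f a - f b" using add[of a "- b"] minus[of b] by simp
qed

section \<open>Consequences of algebraic independence\<close>

lemma alg_indepD:
  assumes "alg_indep \<phi> n x" "finite E" "\<And>e l. e \<in> E \<Longrightarrow> l \<notin> {1..n} \<Longrightarrow> e l = 0"
    and "(\<Sum>e\<in>E. \<phi> (c e) * (\<Prod>l=1..n. x l ^ e l)) = 0" "e \<in> E"
  shows "c e = 0"
  using assms unfolding alg_indep_def by blast

lemma alg_indep_nonzero: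
  assumes "alg_indep \<phi> n x" "\<phi> 1 = 1" "i \<in> {1..n}"
  shows "x i \<noteq> 0"
proof
  assume x: "x i = 0"
  define e where "e l = (if l = i then 1 else 0 :: nat)" for l
  have "(\<Prod>l=1..n. x l ^ e l) = 0" using x assms(3) by (auto simp: e_def intro!: bexI[of _ i])
  then have "(\<Sum>e\<in>{e}. \<phi> 1 * (\<Prod>l=1..n. x l ^ e l)) = 0" by simp
  then have "(1::'a) = 0"
    using assms(3) by (intro alg_indepD[OF assms(1), of "{e}" "\<lambda>_. 1" e]) (auto simp: e_def)
  then show False by simp
qed

lemma alg_indep_not_proportional:
  assumes indep: "alg_indep \<phi> n x" and "\<phi> 1 = 1" "i \<in> {1..n}" "j \<in> {1..n}" "i \<noteq> j"
    and \<phi>: "\<phi> (- c) = - \<phi> c"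
  shows "x i \<noteq> \<phi> c * x j"
proof
  assume x: "x i = \<phi> c * x j"
  \<comment> \<open>\<open>e m\<close> is the exponent vector of the monomial \<open>x m\<close>.
    The proportionality becomes a two-term relation with coefficients 1 and
    \<open>- c\<close>.\<close>
  define e where "e m l = (if l = m then 1 else 0 :: nat)" for m l :: nat
  have prod_e: "(\<Prod>l=1..n. x l ^ e m l) = x m" if "m \<in> {1..n}" for m
  proof -
    have "(\<Prod>l=1..n. x l ^ e m l) = (\<Prod>l=1..n. if l = m then x l else 1)"
      by (rule prod.cong) (auto simp: e_def)
    then show ?thesis using that by simp
  qed
  have "e i i \<noteq> e j i" using assms(5) by (simp add: e_def)
  then have ne: "e i \<noteq> e j" by metis
  let ?c = "\<lambda>m. if m = e i then 1 else - c"
  have "(\<Sum>e\<in>{e i, e j}. \<phi> (?c e) * (\<Prod>l=1..n. x l ^ e l)) = 0"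
    using ne assms(2,5) \<phi> x prod_e[OF assms(3)] prod_e[OF assms(4)] by simp
  then have "?c (e i) = 0"
    using assms(3,4) by (intro alg_indepD[OF indep, of "{e i, e j}" ?c]) (auto simp: e_def)
  then show False by simp
qed

lemma cluster_variable_nonzero:
  assumes "cluster_structure_in \<iota> C" "i \<in> {1..nvars C}"
  shows "init_cluster C i \<noteq> 0"
  by (rule alg_indep_nonzero[where \<phi> = of_int and n = "nvars C"])
    (use assms in \<open>auto simp: cluster_structure_in_def extended_seed_def\<close>)

text \<open>Units of R are constants from the base field, so an association of two variables would
  be a linear relation over that field.\<close>

lemma cluster_variables_not_associated:
  assumes \<iota>: "ring_hom_on UNIV \<iota>" "{a. a dvd 1} = \<iota> ` (UNIV - {0})"
    and C: "cluster_structure_in \<iota> C"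
    and ij: "i \<in> {1..nvars C}" "j \<in> {1..nvars C}" "i \<noteq> j" "u dvd 1"
  shows "init_cluster C i \<noteq> to_fract u * init_cluster C j"
proof -
  obtain c where "u = \<iota> c" using \<iota>(2) ij(4) by blast
  moreover have "init_cluster C i \<noteq> to_fract (\<iota> c) * init_cluster C j"
    by (rule alg_indep_not_proportional[where n = "nvars C"])
      (use \<iota>(1) C ij in \<open>auto simp: cluster_structure_in_def ring_hom_on_UNIV\<close>)
  ultimately show ?thesis by simp
qed

lemma irreducible_cluster_variables_not_dvd:
  fixes \<iota> :: "'k::field_char_0 \<Rightarrow> 'a::{idom, factorial_semiring}"
  assumes \<iota>: "ring_hom_on UNIV \<iota>" "{a. a dvd 1} = \<iota> ` (UNIV - {0})"
    and C: "cluster_structure_in \<iota> C"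
    and ij: "i \<in> {1..nvars C}" "j \<in> {1..nvars C}" "i \<noteq> j"
    and a: "init_cluster C i = to_fract a" "irreducible a"
    and b: "init_cluster C j = to_fract b" "irreducible b"
  shows "\<not> a dvd b"
proof
  assume "a dvd b"
  then obtain u where u: "u dvd 1" "b = u * a" by (rule irreducible_dvd_irreducible[OF a(2) b(2)])
  show False
    using cluster_variables_not_associated[OF \<iota> C ij(2,1) ij(3)[symmetric] u(1)] a(1) b(1) u(2) by simp
qed

section \<open>Laurent rings and the upper cluster algebra\<close>

lemma fst_mutate_other: "i \<noteq> k \<Longrightarrow> fst (mutate C k \<Sigma>) i = fst \<Sigma> i"
  by (simp add: mutate_def Let_def)

lemma init_in_seeds: "init_seed C \<in> seeds C"
  by (auto simp: seeds_def mutate_seq_def intro!: exI[of _ "[]"])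

lemma mutate_init_in_seeds: "k \<in> {1..rank C} \<Longrightarrow> mutate C k (init_seed C) \<in> seeds C"
  by (auto simp: seeds_def mutate_seq_def intro!: exI[of _ "[k]"])

lemma laurent_ring_subset:
  assumes "subring_set T" "\<And>i. i \<in> {1..nvars C} \<Longrightarrow> x i \<in> T"
    and "\<And>i. i \<in> {1..rank C} \<Longrightarrow> inverse (x i) \<in> T"
  shows "laurent_ring C x \<subseteq> T"
  unfolding laurent_ring_def
proof (rule localize_minimal[OF assms(1)])
  show "poly_ring C x \<subseteq> T"
    unfolding poly_ring_def by (rule hull_minimal) (use assms in auto)
qed (use assms in auto)

lemma i_admissible_obtain:
  assumes "i_admissible C (init_cluster C ` {1..nvars C})"
  obtains b where "\<And>i. i \<in> {1..nvars C} \<Longrightarrow> init_cluster C i = to_fract (b i) \<and> irreducible (b i)"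
proof -
  have "\<forall>i\<in>{1..nvars C}. \<exists>b. init_cluster C i = to_fract b \<and> irreducible b"
    using assms by (auto simp: i_admissible_def)
  then show thesis using that by metis
qed

lemma i_admissible_mutation:
  assumes "i_admissible C (init_cluster C ` {1..nvars C})" "k \<in> {1..rank C}"
    "init_cluster C k = to_fract b"
  obtains a where "fst (mutate C k (init_seed C)) k = to_fract a" "coprime_elems a b"
proof -
  have "init_cluster C k \<in> init_cluster C ` {1..nvars C}" using assms(2) by auto
  then obtain a a' where "init_cluster C k = to_fract a"
    "fst (mutate C k (init_seed C)) k = to_fract a'" "coprime_elems a' a"
    using assms(1,2) unfolding i_admissible_def by blast
  then show thesis using that assms(3) by simp
qed

lemma upper_cluster_algebra_subset:
  fixes \<iota> :: "'k::field_char_0 \<Rightarrow> 'a::{idom, factorial_semiring}"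
  assumes \<iota>: "ring_hom_on UNIV \<iota>" "{a. a dvd 1} = \<iota> ` (UNIV - {0})"
    and C: "cluster_structure_in \<iota> C"
    and adm: "i_admissible C (init_cluster C ` {1..nvars C})"
  shows "upper_cluster_algebra C \<subseteq> range to_fract"
proof
  fix f assume f: "f \<in> upper_cluster_algebra C"
  obtain b where b: "\<And>i. i \<in> {1..nvars C} \<Longrightarrow> init_cluster C i = to_fract (b i) \<and> irreducible (b i)"
    using i_admissible_obtain[OF adm] by blast
  show "f \<in> range to_fract"
  proof (rule range_to_fract_if_loc_at)
    fix p :: 'a assume p: "prime_elem p"
    note sub = subring_set_loc_at[OF p]
    have in_loc: "to_fract a \<in> loc_at p" for a using range_to_fract_subset_loc_at[OF p] by auto
    show "f \<in> loc_at p"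
    proof (cases "\<exists>k\<in>{1..rank C}. p dvd b k")
      \<comment> \<open>The Laurent ring inverts cluster variables only, so frozen variables
        divisible by \<open>p\<close> do no harm.\<close>
      case False
      have "laurent_ring C (init_cluster C) \<subseteq> loc_at p"
      proof (rule laurent_ring_subset[OF sub])
        show "init_cluster C i \<in> loc_at p" if "i \<in> {1..nvars C}" for i
          using b[OF that] in_loc by simp
        show "inverse (init_cluster C i) \<in> loc_at p" if "i \<in> {1..rank C}" for i
          using b[of i] inverse_in_loc_at[of p "b i"] False that by simp
      qed
      then show ?thesis using f init_in_seeds[of C] by (auto simp: upper_cluster_algebra_def)
    next
      case True
      then obtain k where k: "k \<in> {1..rank C}" "p dvd b k" by blast
      have kn: "k \<in> {1..nvars C}" using k by auto
      obtain u where u: "u dvd 1" "b k = u * p"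
        using irreducible_dvd_irreducible[of p "b k"] b[OF kn] p k(2)
        by (auto simp: prime_elem_iff_irreducible)
      have *: "b k dvd z" if "p dvd z" for z using u that by (simp add: mult_unit_dvd_iff')
      obtain a where a: "fst (mutate C k (init_seed C)) k = to_fract a" "coprime_elems a (b k)"
        using i_admissible_mutation[OF adm k(1)] b[OF kn] by blast
      \<comment> \<open>\<open>p\<close> and \<open>b k\<close> are associated, so coprimality of
        the mutation with \<open>b k\<close> makes \<open>a\<close> invertible in
        \<open>loc_at p\<close>.\<close>
      have pa: "\<not> p dvd a"
        using * a(2) b[OF kn] coprime_elems_prime_elem_iff[of "b k" a]
        by (auto simp: prime_elem_iff_irreducible)
      \<comment> \<open>If \<open>p\<close> divided another variable, so would its associate
        \<open>b k\<close>, against algebraic independence.\<close>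
      have pb: "\<not> p dvd b i" if "i \<in> {1..nvars C}" "i \<noteq> k" for i
        using * irreducible_cluster_variables_not_dvd[OF \<iota> C kn that(1) that(2)[symmetric]]
          b[OF kn] b[OF that(1)] by blast
      have "laurent_ring C (fst (mutate C k (init_seed C))) \<subseteq> loc_at p"
      proof (rule laurent_ring_subset[OF sub])
        show "fst (mutate C k (init_seed C)) i \<in> loc_at p" if "i \<in> {1..nvars C}" for i
          using a(1) b[OF that] in_loc by (cases "i = k") (auto simp: fst_mutate_other)
        show "inverse (fst (mutate C k (init_seed C)) i) \<in> loc_at p" if "i \<in> {1..rank C}" for i
          using a(1) b[of i] pa pb[of i] that inverse_in_loc_at[of p a] inverse_in_loc_at[of p "b i"]
          by (cases "i = k") (simp_all add: fst_mutate_other)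
      qed
      then show ?thesis
        using f mutate_init_in_seeds[OF k(1)] by (auto simp: upper_cluster_algebra_def)
    qed
  qed
qed

text \<open>R is a linear subspace of Frac R over the base field, so the inclusion passes to the
  span.\<close>

lemma upper_cluster_algebra_over_subset:
  fixes \<iota> :: "'k::field_char_0 \<Rightarrow> 'a::{idom, factorial_semiring}"
  assumes \<iota>: "ring_hom_on UNIV \<iota>" "{a. a dvd 1} = \<iota> ` (UNIV - {0})"
    and C: "cluster_structure_in \<iota> C"
    and adm: "i_admissible C (init_cluster C ` {1..nvars C})"
  shows "upper_cluster_algebra_over \<iota> C \<subseteq> range to_fract"
proof -
  have m: "module (\<lambda>c f. to_fract (\<iota> c) * f)"
    by unfold_locales (simp_all add: ring_hom_on_UNIV[OF \<iota>(1)] algebra_simps)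
  note R = subring_set_range_to_fract
  show ?thesis
    unfolding upper_cluster_algebra_over_def
    by (intro module.span_minimal[OF m upper_cluster_algebra_subset[OF assms]] module.subspaceI[OF m]
        subring_set_0[OF R] subring_set_add[OF R] subring_set_mult[OF R] rangeI)
qed


section \<open>Irreducibility from two complementary localizations\<close>

text \<open>More integer vectors (indexed by \<open>L\<close>) than coordinates (indexed by
  \<open>I\<close>) are linearly dependent over the integers. The induction eliminates one
  coordinate.\<close>

lemma int_linear_dependency:
  fixes a :: "'l \<Rightarrow> 'i \<Rightarrow> int"
  assumes "finite I" "finite L" "card I < card L"
  shows "\<exists>n. (\<exists>l\<in>L. n l \<noteq> 0) \<and> (\<forall>i\<in>I. (\<Sum>l\<in>L. n l * a l i) = 0)"
  using assms
proof (induction I arbitrary: L a rule: finite_induct)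
  case empty
  then have "L \<noteq> {}" by auto
  then show ?case by (intro exI[of _ "\<lambda>_. 1"]) auto
next
  case (insert i I)
  show ?case
  proof (cases "\<forall>l\<in>L. a l i = 0")
    case True
    obtain n where "\<exists>l\<in>L. n l \<noteq> 0" "\<forall>j\<in>I. (\<Sum>l\<in>L. n l * a l j) = 0"
      using insert.IH[OF insert.prems(1), of a] insert.hyps insert.prems(2) by auto
    then show ?thesis using True by (intro exI[of _ n]) auto
  next
    case False
    then obtain r where r: "r \<in> L" "a r i \<noteq> 0" by blast
    \<comment> \<open>Elimination without division: with \<open>r\<close> as pivot, the coordinate
      \<open>i\<close> of every \<open>b l\<close> vanishes.\<close>
    define b where "b l j = a r i * a l j - a l i * a r j" for l j
    have "finite (L - {r})" "card I < card (L - {r})"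
      using insert.prems insert.hyps r by auto
    from insert.IH[OF this, of b] obtain n where
      n: "\<exists>l\<in>L - {r}. n l \<noteq> 0" "\<forall>j\<in>I. (\<Sum>l\<in>L - {r}. n l * b l j) = 0" by blast
    \<comment> \<open>The coefficient at \<open>r\<close> is chosen so that the combination of the
      \<open>a l\<close> over \<open>L\<close> equals that of the \<open>b l\<close> over
      \<open>L - {r}\<close>.\<close>
    define n' where "n' l = (if l = r then - (\<Sum>l\<in>L - {r}. n l * a l i) else a r i * n l)" for l
    have n'_other: "(\<Sum>l\<in>L - {r}. n' l * a l j) = (\<Sum>l\<in>L - {r}. a r i * n l * a l j)" for j
      by (rule sum.cong) (auto simp: n'_def)
    have sum: "(\<Sum>l\<in>L. n' l * a l j) = (\<Sum>l\<in>L - {r}. n l * b l j)" for j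
      unfolding sum.remove[OF insert.prems(1) r(1)] n'_other
      by (simp add: n'_def b_def sum_distrib_left sum_distrib_right sum_subtractf algebra_simps)
    have "(\<Sum>l\<in>L. n' l * a l j) = 0" if "j \<in> insert i I" for j
      using that n(2) unfolding sum by (auto simp: b_def)
    moreover have "\<exists>l\<in>L. n' l \<noteq> 0" using n(1) r(2) by (auto simp: n'_def)
    ultimately show ?thesis by blast
  qed
qed

text \<open>In the application, \<open>b i\<close> is the initial variable \<open>x\<^sub>i\<close> and \<open>I\<close> the set of marked indices.
  The last axiom bounds the rank of the group of units of \<open>S\<close> modulo the units of \<open>R\<close>.\<close>

locale marked_localization = localization "b ` I" S
  for n :: nat and I :: "nat set" and b :: "nat \<Rightarrow> 'a::{idom, factorial_semiring}" and S +
  assumes I_subset: "I \<subseteq> {1..n}"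
    and b_nonzero: "i \<in> {1..n} \<Longrightarrow> b i \<noteq> 0"
    and b_not_unit: "i \<in> {1..n} - I \<Longrightarrow> \<not> unit_in S (to_fract (b i))"
    and b_mult: "i \<in> {1..n} - I \<Longrightarrow> b i = y * z \<Longrightarrow> unit_in S (to_fract y) \<or> unit_in S (to_fract z)"
    and b_common_prime: "i \<in> {1..n} - I \<Longrightarrow> j \<in> {1..n} - I \<Longrightarrow> i \<noteq> j \<Longrightarrow>
      prime_elem q \<Longrightarrow> q dvd b i \<Longrightarrow> q dvd b j \<Longrightarrow> unit_in S (to_fract q)"
    and unit_rank: "finite (L :: nat set) \<Longrightarrow>
      (\<And>l. l \<in> L \<Longrightarrow> prime_elem (p l) \<and> unit_in S (to_fract (p l))) \<Longrightarrow>
      (\<And>l m. l \<in> L \<Longrightarrow> m \<in> L \<Longrightarrow> l \<noteq> m \<Longrightarrow> \<not> p l dvd p m) \<Longrightarrow> card L \<le> card I"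
begin

lemma unit_in_if_prime_divisors:
  assumes "x \<noteq> 0" "\<And>q. prime_elem q \<Longrightarrow> q dvd x \<Longrightarrow> unit_in S (to_fract q)"
  shows "unit_in S (to_fract x)"
  using assms
proof (induction x rule: prime_divisors_induct)
  case (unit x)
  then show ?case by (simp add: unit_in_unit)
next
  case (factor p x)
  have "unit_in S (to_fract p)" using factor.prems(2)[of p] factor.hyps by auto
  moreover have "unit_in S (to_fract x)"
    using factor.prems by (intro factor.IH) auto
  ultimately show ?case by (simp add: unit_in_mult subring_S)
qed simp

text \<open>\<open>b i\<close> is not a unit of \<open>S\<close>, so neither are all its prime
  divisors; by \<open>b_mult\<close> the cofactor of such a prime is a unit of
  \<open>S\<close>.\<close>

lemma b_factor:
  assumes "i \<in> {1..n} - I"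
  obtains q u where "b i = q * u" "prime_elem q" "\<not> unit_in S (to_fract q)" "unit_in S (to_fract u)"
proof -
  obtain q where q: "prime_elem q" "q dvd b i" "\<not> unit_in S (to_fract q)"
    using unit_in_if_prime_divisors[of "b i"] b_not_unit[OF assms] b_nonzero[of i] assms by blast
  then obtain u where "b i = q * u" by blast
  then show thesis using that q b_mult[OF assms] by blast
qed

lemma unit_in_b: "i \<in> I \<Longrightarrow> unit_in S (to_fract (b i))"
  by (rule unit_in_generator) simp

end

text \<open>Each variable marked for \<open>S\<close> is unmarked for \<open>S'\<close> and so has a
  prime factor \<open>q j\<close> that is no unit of \<open>S'\<close>. These primes together with
  \<open>p\<close> would be pairwise non-associated units of \<open>S\<close>, one more than
  \<open>unit_rank\<close> allows.\<close>

lemma prime_not_unit_in_both: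
  assumes "marked_localization n I b S" "marked_localization n I' b S'" "I \<inter> I' = {}"
    and p: "prime_elem p" "unit_in S (to_fract p)"
  shows "\<not> unit_in S' (to_fract p)"
proof
  interpret marked_localization n I b S by fact
  interpret M': marked_localization n I' b S' by fact
  assume p': "unit_in S' (to_fract p)"
  have "\<exists>q. prime_elem q \<and> q dvd b j \<and> \<not> unit_in S' (to_fract q)" if "j \<in> I" for j
  proof -
    have "j \<in> {1..n} - I'" using that assms(3) I_subset by auto
    then show ?thesis using M'.b_factor[of j] by (metis dvd_triv_left)
  qed
  then obtain q where q: "\<And>j. j \<in> I \<Longrightarrow> prime_elem (q j)" "\<And>j. j \<in> I \<Longrightarrow> q j dvd b j"
    "\<And>j. j \<in> I \<Longrightarrow> \<not> unit_in S' (to_fract (q j))" by metis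
  \<comment> \<open>Variables are numbered from 1, so the index 0 is free for
    \<open>p\<close>.\<close>
  define r where "r = q(0 := p)"
  have r: "r 0 = p" "\<And>j. j \<in> I \<Longrightarrow> r j = q j" using I_subset by (auto simp: r_def)
  have dvd_sym: "q j dvd p" if "j \<in> I" "p dvd q j" for j
    using irreducible_dvd_irreducible[of p "q j"] q(1)[OF that(1)] p(1) that(2)
    by (metis mult_unit_dvd_iff' prime_elem_iff_irreducible dvd_refl)
  have "card (insert 0 I) \<le> card I"
  proof (rule unit_rank[of _ r])
    show "finite (insert 0 I)" using I_subset finite_subset by auto
    show "prime_elem (r l) \<and> unit_in S (to_fract (r l))" if "l \<in> insert 0 I" for l
      using that p q unit_in_dvd[OF unit_in_b] by (auto simp: r)
    have *: "\<not> q j dvd p" if "j \<in> I" for j using q(3)[OF that] M'.unit_in_dvd[OF p'] by blast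
    \<comment> \<open>Otherwise \<open>q j\<close> would be a common prime of two variables unmarked
      for \<open>S'\<close>, hence a unit there.\<close>
    have **: "\<not> q j dvd q k" if "j \<in> I" "k \<in> I" "j \<noteq> k" for j k
    proof
      assume "q j dvd q k"
      then have "q j dvd b k" using q(2)[OF that(2)] by (rule dvd_trans)
      then show False
        using M'.b_common_prime[of j k "q j"] q that assms(3) I_subset by blast
    qed
    show "\<not> r l dvd r m" if "l \<in> insert 0 I" "m \<in> insert 0 I" "l \<noteq> m" for l m
      using that * ** dvd_sym by (auto simp: r)
  qed
  moreover have "0 \<notin> I" "finite I" using I_subset finite_subset by auto
  ultimately show False by simp
qed

text \<open>By \<open>b_factor\<close>, \<open>b i\<close> is a prime times a unit \<open>u\<close>
  of \<open>S\<close>. A prime factor of \<open>u\<close> is a unit of \<open>S\<close>, so it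
  divides a marked variable \<open>b j\<close>, and it is no unit of \<open>S'\<close>. Both
  possibilities for \<open>i\<close> relative to \<open>I'\<close> contradict this.\<close>

lemma irreducible_unmarked:
  assumes "marked_localization n I b S" "marked_localization n I' b S'" "I \<inter> I' = {}"
    and i: "i \<in> {1..n} - I"
  shows "irreducible (b i)"
proof -
  interpret marked_localization n I b S by fact
  interpret M': marked_localization n I' b S' by fact
  obtain q u where qu: "b i = q * u" "prime_elem q" "unit_in S (to_fract u)"
    using b_factor[OF i] by blast
  have "u dvd 1"
  proof (rule ccontr)
    assume "\<not> u dvd 1"
    moreover have "u \<noteq> 0" using qu(3) by (auto simp: unit_in_def)
    ultimately obtain p where "prime p" "p dvd u" using prime_divisorE by blast
    then have p: "prime_elem p" "unit_in S (to_fract p)" "p dvd b i"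
      using qu(1) unit_in_dvd[OF qu(3)] by auto
    have not_unit: "\<not> unit_in S' (to_fract p)"
      using prime_not_unit_in_both[OF assms(1-3) p(1,2)] .
    obtain j where j: "j \<in> I" "p dvd b j"
      using prime_unit_in_dvd_generator[OF p(1,2)] by blast
    show False
    \<comment> \<open>If \<open>i\<close> is marked for \<open>S'\<close>, then \<open>p\<close>
      divides a unit of \<open>S'\<close>. Otherwise \<open>i\<close> and \<open>j\<close> are both
      unmarked for \<open>S'\<close>, and their common prime \<open>p\<close> is a unit of
      \<open>S'\<close>.\<close>
    proof (cases "i \<in> I'")
      case True
      then show False using not_unit M'.unit_in_dvd[OF M'.unit_in_b p(3)] by blast
    next
      case False
      then show False
        using M'.b_common_prime[OF _ _ _ p(1,3) j(2)] not_unit i j(1) assms(3) I_subset by blast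
    qed
  qed
  then show ?thesis
    using qu(1,2) by (simp add: irreducible_mult_unit_left mult.commute[of q] prime_elem_iff_irreducible)
qed

text \<open>Each index is unmarked for at least one of the two localizations, and their roles are
  symmetric.\<close>

lemma irreducible_if_complementary:
  assumes "marked_localization n I b S" "marked_localization n I' b S'" "I \<inter> I' = {}" "i \<in> {1..n}"
  shows "irreducible (b i)"
  using irreducible_unmarked[OF assms(1-3)] irreducible_unmarked[OF assms(2,1)] assms(3,4) by blast


section \<open>Isomorphisms of subrings\<close>

lemma ring_iso_onD:
  assumes "ring_iso_on F A B" "subring_set A"
  shows ring_iso_on_1: "F 1 = 1"
    and ring_iso_on_0: "F 0 = 0"
    and ring_iso_on_add: "\<And>a b. a \<in> A \<Longrightarrow> b \<in> A \<Longrightarrow> F (a + b) = F a + F b"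
    and ring_iso_on_mult: "\<And>a b. a \<in> A \<Longrightarrow> b \<in> A \<Longrightarrow> F (a * b) = F a * F b"
    and ring_iso_on_diff: "\<And>a b. a \<in> A \<Longrightarrow> b \<in> A \<Longrightarrow> F (a - b) = F a - F b"
    and ring_iso_on_in: "\<And>a. a \<in> A \<Longrightarrow> F a \<in> B"
    and ring_iso_on_inj: "inj_on F A"
    and ring_iso_on_surj: "\<And>b. b \<in> B \<Longrightarrow> \<exists>a\<in>A. b = F a"
proof -
  show "F 1 = 1" and add: "\<And>a b. a \<in> A \<Longrightarrow> b \<in> A \<Longrightarrow> F (a + b) = F a + F b"
    and "\<And>a b. a \<in> A \<Longrightarrow> b \<in> A \<Longrightarrow> F (a * b) = F a * F b"
    and "\<And>a. a \<in> A \<Longrightarrow> F a \<in> B" and "inj_on F A" and "\<And>b. b \<in> B \<Longrightarrow> \<exists>a\<in>A. b = F a"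
    using assms(1) by (auto simp: ring_iso_on_def ring_hom_on_def bij_betw_def)
  show "F 0 = 0" using add[of 0 0] subring_set_0[OF assms(2)] by simp
  show "F (a - b) = F a - F b" if "a \<in> A" "b \<in> A" for a b
    using add[OF subring_set_diff[OF assms(2) that] that(2)] by simp
qed

lemma ring_iso_on_power:
  assumes "ring_iso_on F A B" "subring_set A" "a \<in> A"
  shows "F (a ^ n) = F a ^ n"
  by (induction n)
    (use assms in \<open>simp_all add: ring_iso_on_1 ring_iso_on_mult subring_set_power\<close>)

lemma ring_iso_on_prod:
  fixes f :: "'i \<Rightarrow> 'a::comm_ring_1" and F :: "'a \<Rightarrow> 'b::comm_ring_1"
  assumes "ring_iso_on F A B" "subring_set A" "\<And>i. i \<in> I \<Longrightarrow> f i \<in> A"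
  shows "F (prod f I) = (\<Prod>i\<in>I. F (f i))"
  using assms(3)
  by (induction I rule: infinite_finite_induct)
    (simp_all add: ring_iso_on_1[OF assms(1,2)] ring_iso_on_mult[OF assms(1,2)] subring_set_prod[OF assms(2)])

lemma ring_iso_on_of_nat:
  assumes "ring_iso_on F A B" "subring_set A"
  shows "of_nat m \<in> A \<and> F (of_nat m) = of_nat m"
  by (induction m)
    (use assms in \<open>simp_all add: ring_iso_on_0 ring_iso_on_1 ring_iso_on_add subring_set_0 subring_set_1 subring_set_add\<close>)

lemma ring_iso_on_unit_in:
  fixes F :: "'a::field \<Rightarrow> 'b::field"
  assumes F: "ring_iso_on F A B" and A: "subring_set A" and f: "f \<in> A"
  shows "unit_in B (F f) \<longleftrightarrow> unit_in A f"
proof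
  assume "unit_in A f"
  then have inv: "inverse f \<in> A" "f \<noteq> 0" by (auto simp: unit_in_def)
  have "F f * F (inverse f) = 1"
    using ring_iso_on_mult[OF F A f inv(1)] inv(2) ring_iso_on_1[OF F A] by simp
  then have "inverse (F f) = F (inverse f)" "F f \<noteq> 0" by (auto simp: inverse_unique)
  then show "unit_in B (F f)"
    using ring_iso_on_in[OF F A] f inv(1) by (simp add: unit_in_def)
next
  assume u: "unit_in B (F f)"
  then obtain g where g: "g \<in> A" "inverse (F f) = F g"
    using ring_iso_on_surj[OF F A] unfolding unit_in_def by blast
  have "F (f * g) = F 1"
    using u ring_iso_on_mult[OF F A f g(1)] ring_iso_on_1[OF F A]
    by (simp add: g(2)[symmetric] unit_in_def)
  then have "f * g = 1"
    using ring_iso_on_inj[OF F A] subring_set_mult[OF A f g(1)] subring_set_1[OF A]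
    by (simp add: inj_on_eq_iff)
  then have "inverse f = g" "f \<noteq> 0" by (auto simp: inverse_unique)
  then show "unit_in A f" using f g(1) by (simp add: unit_in_def)
qed

lemma to_fract_of_nat: "to_fract (of_nat m) = of_nat m"
  by (induction m) simp_all

lemma to_fract_power: "to_fract (a ^ n) = to_fract a ^ n"
  by (induction n) simp_all

lemma to_fract_prod: "to_fract (prod f I) = (\<Prod>i\<in>I. to_fract (f i))"
  by (induction I rule: infinite_finite_induct) simp_all

lemma ring_hom_on_UNIV_of_nat:
  assumes "ring_hom_on UNIV f" shows "f (of_nat m) = of_nat m"
  by (induction m) (simp_all add: ring_hom_on_UNIV[OF assms])


section \<open>Units of a localization at primes\<close>

definition fract_unit :: "'a::idom fract \<Rightarrow> bool" where
  "fract_unit f \<longleftrightarrow> (\<exists>c. c dvd 1 \<and> f = to_fract c)"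

lemma fract_unit_1: "fract_unit 1"
  unfolding fract_unit_def by (intro exI[of _ 1]) simp

lemma fract_unit_mult: "fract_unit f \<Longrightarrow> fract_unit g \<Longrightarrow> fract_unit (f * g)"
proof -
  assume "fract_unit f" "fract_unit g"
  then obtain c d where "c dvd 1" "f = to_fract c" "d dvd 1" "g = to_fract d"
    by (auto simp: fract_unit_def)
  then show ?thesis
    using mult_dvd_mono[of c 1 d 1] unfolding fract_unit_def by (intro exI[of _ "c * d"]) simp
qed

lemma fract_unit_inverse: "fract_unit f \<Longrightarrow> fract_unit (inverse f)"
proof -
  assume "fract_unit f"
  then obtain c where c: "c dvd 1" "f = to_fract c" by (auto simp: fract_unit_def)
  then obtain d where d: "1 = c * d" by blast
  then have "to_fract c * to_fract d = 1" by (metis to_fract_1 to_fract_mult)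
  then have "inverse f = to_fract d" by (simp add: c(2) inverse_unique)
  moreover have "d dvd 1" unfolding d by simp
  ultimately show ?thesis by (auto simp: fract_unit_def)
qed

lemma fract_unit_power_int: "fract_unit f \<Longrightarrow> fract_unit (f powi n)"
proof -
  have "fract_unit g \<Longrightarrow> fract_unit (g ^ m)" for g :: "'a fract" and m
    by (induction m) (simp_all add: fract_unit_1 fract_unit_mult)
  then show "fract_unit f \<Longrightarrow> fract_unit (f powi n)"
    by (simp add: power_int_def fract_unit_inverse)
qed

lemma fract_unit_prod: "(\<And>i. i \<in> I \<Longrightarrow> fract_unit (f i)) \<Longrightarrow> fract_unit (prod f I)"
  by (induction I rule: infinite_finite_induct) (simp_all add: fract_unit_1 fract_unit_mult)

lemma prod_power_int: "(\<Prod>i\<in>I. f i) powi m = (\<Prod>i\<in>I. f i powi m :: 'a::field)"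
  by (induction I rule: infinite_finite_induct) (simp_all add: power_int_mult_distrib)

lemma power_int_sum: "x \<noteq> 0 \<Longrightarrow> (x::'a::field) powi (\<Sum>i\<in>I. f i) = (\<Prod>i\<in>I. x powi f i)"
  by (induction I rule: infinite_finite_induct) (simp_all add: power_int_add)

lemma prod_power_int_add:
  fixes x :: "'i \<Rightarrow> 'a::field"
  assumes "\<And>j. j \<in> J \<Longrightarrow> x j \<noteq> 0"
  shows "(\<Prod>j\<in>J. x j powi (\<alpha> j + \<beta> j)) = (\<Prod>j\<in>J. x j powi \<alpha> j) * (\<Prod>j\<in>J. x j powi \<beta> j)"
  unfolding prod.distrib[symmetric] by (rule prod.cong) (use assms in \<open>auto simp: power_int_add\<close>)

lemma prod_power_int_minus:
  fixes x :: "'i \<Rightarrow> 'a::field"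
  shows "(\<Prod>j\<in>J. x j powi (- \<alpha> j)) = inverse (\<Prod>j\<in>J. x j powi \<alpha> j)"
  using prod_inversef[of "\<lambda>j. x j powi \<alpha> j" J] by (simp add: power_int_minus o_def)

text \<open>When the generators are prime, a prime that becomes a unit is associated to one of them.
  Factoring numerator and denominator then gives a Laurent monomial in the generators times a unit
  of R.\<close>

lemma (in localization) unit_in_monomial:
  assumes X: "X = t ` J" and J: "finite J" and t: "\<And>j. j \<in> J \<Longrightarrow> prime_elem (t j)"
    and f: "unit_in S f"
  shows "\<exists>c \<alpha>. fract_unit c \<and> f = c * (\<Prod>j\<in>J. to_fract (t j) powi \<alpha> j)"
proof -
  have t0: "to_fract (t j) \<noteq> 0" if "j \<in> J" for j using t[OF that] by auto
  have *: "\<exists>c \<alpha>. fract_unit c \<and> to_fract r = c * (\<Prod>j\<in>J. to_fract (t j) powi \<alpha> j)"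
    if "unit_in S (to_fract r)" for r
    using that
  proof (induction r rule: prime_divisors_induct)
    case zero
    then show ?case by (simp add: unit_in_def)
  next
    case (unit r)
    then show ?case
      by (intro exI[of _ "to_fract r"] exI[of _ "\<lambda>_. 0"]) (auto simp: fract_unit_def)
  next
    case (factor p r)
    have p: "prime_elem p" "unit_in S (to_fract p)" "unit_in S (to_fract r)"
      using factor.hyps unit_in_dvd[OF factor.prems] by auto
    obtain c \<alpha> where c: "fract_unit c" "to_fract r = c * (\<Prod>j\<in>J. to_fract (t j) powi \<alpha> j)"
      using factor.IH[OF p(3)] by blast
    obtain j where j: "j \<in> J" "p dvd t j"
      using prime_unit_in_dvd_generator[OF p(1,2)] X by blast
    obtain u where u: "u dvd 1" "t j = u * p"
      using irreducible_dvd_irreducible[of p "t j"] p(1) t[OF j(1)] j(2)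
      by (auto simp: prime_elem_iff_irreducible)
    have fu: "fract_unit (to_fract u)" using u(1) by (auto simp: fract_unit_def)
    have "to_fract p = inverse (to_fract u) * to_fract (t j)"
      using u p(1) by (auto simp: field_simps)
    \<comment> \<open>A single generator is written as a monomial with indicator exponents, so that
      exponent vectors can be added.\<close>
    also have "to_fract (t j) = (\<Prod>i\<in>J. to_fract (t i) powi (if i = j then 1 else 0))"
    proof -
      have "(\<Prod>i\<in>J. to_fract (t i) powi (if i = j then 1 else 0)) =
          (\<Prod>i\<in>J. if i = j then to_fract (t i) else 1)"
        by (rule prod.cong) auto
      then show ?thesis using j(1) J by simp
    qed
    finally have "to_fract (p * r) = (inverse (to_fract u) * c) *
        (\<Prod>i\<in>J. to_fract (t i) powi ((if i = j then 1 else 0) + \<alpha> i))"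
      using t0 c(2) by (simp add: prod_power_int_add)
    then show ?case
      using fract_unit_mult[OF fract_unit_inverse[OF fu] c(1)]
      by (intro exI[of _ "inverse (to_fract u) * c"]
          exI[of _ "\<lambda>i. (if i = j then 1 else 0) + \<alpha> i"]) simp
  qed
  obtain r m where rm: "f = to_fract r / to_fract m" "unit_in S (to_fract m)"
    using S_fraction f by (auto simp: unit_in_def)
  then have "to_fract r = f * to_fract m" by (auto simp: unit_in_def)
  then have "unit_in S (to_fract r)" using unit_in_mult[OF subring_S f rm(2)] by simp
  then obtain c \<alpha> d \<beta> where
    c: "fract_unit c" "to_fract r = c * (\<Prod>j\<in>J. to_fract (t j) powi \<alpha> j)" and
    d: "fract_unit d" "to_fract m = d * (\<Prod>j\<in>J. to_fract (t j) powi \<beta> j)"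
    using *[OF rm(2)] * by metis
  have "f = (c * inverse d) * (\<Prod>j\<in>J. to_fract (t j) powi (\<alpha> j + (- \<beta> j)))"
    using prod_power_int_add[of J "\<lambda>j. to_fract (t j)" \<alpha> "\<lambda>j. - \<beta> j", OF t0]
      prod_power_int_minus[of "\<lambda>j. to_fract (t j)" \<beta> J]
    by (simp add: rm(1) c(2) d(2) divide_inverse)
  then show ?thesis
    using fract_unit_mult[OF c(1) fract_unit_inverse[OF d(1)]]
    by (intro exI[of _ "c * inverse d"] exI[of _ "\<lambda>j. \<alpha> j + (- \<beta> j)"] conjI)
qed


section \<open>Birational quasi-isomorphisms\<close>

text \<open>Unspecified where the extended cluster is not regular.\<close>

definition init_elem :: "('a::idom fract, 'z) cluster_structure_scheme \<Rightarrow> nat \<Rightarrow> 'a" where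
  "init_elem C i = (SOME a. init_cluster C i = to_fract a)"

lemma to_fract_init_elem:
  assumes "regular (init_cluster C ` {1..nvars C})" "i \<in> {1..nvars C}"
  shows "to_fract (init_elem C i) = init_cluster C i"
proof -
  have "init_cluster C i \<in> range to_fract"
    using assms unfolding regular_def by (auto dest!: subsetD)
  then have "\<exists>a. init_cluster C i = to_fract a" by blast
  then show ?thesis unfolding init_elem_def by (metis (mono_tags) someI_ex)
qed

text \<open>The product is the right-hand side of the exchange relation.\<close>

lemma mutation_mult_in_poly_ring:
  assumes "init_cluster C k \<noteq> 0"
  shows "fst (mutate C k (init_seed C)) k * init_cluster C k \<in> poly_ring C (init_cluster C)"
proof -
  have sub: "subring_set (poly_ring C (init_cluster C))"
    unfolding poly_ring_def by (rule subring_set_hull)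
  have "init_cluster C j \<in> poly_ring C (init_cluster C)" if "j \<in> {1..nvars C}" for j
    using that unfolding poly_ring_def by (intro hull_inc) auto
  then have "(\<Prod>j | j \<in> {1..nvars C} \<and> P j. init_cluster C j ^ e j) \<in> poly_ring C (init_cluster C)"
    for P e
    by (intro subring_set_prod[OF sub] subring_set_power[OF sub]) auto
  then show ?thesis
    using assms subring_set_add[OF sub] by (simp add: mutate_def Let_def)
qed

text \<open>One half of the complementary pair; the theorem instantiates it once for each
  target.\<close>

locale birational_quasi_isomorphism =
  fixes \<iota> :: "'k::field_char_0 \<Rightarrow> 'a::{idom, factorial_semiring}"
    and \<iota>t :: "'k \<Rightarrow> 'b::{idom, factorial_semiring}"
    and C :: "'a fract cluster_structure"
    and Ct :: "'b fract cluster_structure"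
    and \<kappa> :: "nat \<Rightarrow> nat"
    and Q :: "'a fract \<Rightarrow> 'b fract"
  assumes \<iota>: "ring_hom_on UNIV \<iota>" "{a. a dvd 1} = \<iota> ` (UNIV - {0})"
    and \<iota>t: "ring_hom_on UNIV \<iota>t" "{a. a dvd 1} = \<iota>t ` (UNIV - {0})"
    and C_in: "cluster_structure_in \<iota> C" and Ct_in: "cluster_structure_in \<iota>t Ct"
    and related: "related_triple C Ct \<kappa>"
    and quasi: "quasi_isomorphism C Ct \<kappa> Q" and birational: "birational C Ct \<kappa> Q"
    and admissible: "i_admissible Ct (init_cluster Ct ` {1..nvars Ct})"
    and regular_C: "regular (init_cluster C ` {1..nvars C})"
begin

abbreviation "n \<equiv> nvars C"
abbreviation "I \<equiv> marked_source C Ct \<kappa>"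
abbreviation "x \<equiv> init_cluster C"
abbreviation "xt \<equiv> init_cluster Ct"
abbreviation "b \<equiv> init_elem C"
abbreviation "t \<equiv> init_elem Ct"

text \<open>\<open>S\<close> and \<open>T\<close> are the two localizations in
  \<open>birational\<close>, with generators written as ring elements. \<open>A\<close> is the
  subring on which the extension of \<open>Q\<close> is prescribed.\<close>

definition "S = localize (range to_fract) (to_fract ` b ` I)"
definition "T = localize (range to_fract) (to_fract ` t ` \<kappa> ` I)"
definition "A = localize (poly_ring C x) (x ` I)"

lemma n_Ct: "nvars Ct = n"
  using related by (simp add: related_triple_def)

lemma I_subset: "I \<subseteq> {1..n}"
  by (auto simp: marked_source_def)

lemma finite_I: "finite I"
  using I_subset finite_subset by blast

lemma \<kappa>_in: "i \<in> {1..n} \<Longrightarrow> \<kappa> i \<in> {1..n}"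
  using related unfolding related_triple_def bij_betw_def by blast

lemma \<kappa>_inj: "i \<in> {1..n} \<Longrightarrow> j \<in> {1..n} \<Longrightarrow> \<kappa> i = \<kappa> j \<Longrightarrow> i = j"
  using related unfolding related_triple_def bij_betw_def inj_on_def by blast

lemma \<kappa>_image_I: "\<kappa> ` I = marked_target C Ct \<kappa>"
  by (auto simp: marked_source_def marked_target_def)

lemma \<kappa>_mutable: "k \<in> {1..rank C} - I \<Longrightarrow> \<kappa> k \<in> {1..rank Ct}"
  using \<kappa>_in[of k] n_Ct by (auto simp: marked_source_def marked_target_def)

lemma to_fract_b: "i \<in> {1..n} \<Longrightarrow> to_fract (b i) = x i"
  by (rule to_fract_init_elem[OF regular_C])

lemma x_nonzero: "i \<in> {1..n} \<Longrightarrow> x i \<noteq> 0"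
  by (rule cluster_variable_nonzero[OF C_in])

lemma to_fract_t: "i \<in> {1..n} \<Longrightarrow> to_fract (t i) = xt i"
  and irreducible_t: "i \<in> {1..n} \<Longrightarrow> irreducible (t i)"
proof -
  obtain a where a: "\<And>i. i \<in> {1..n} \<Longrightarrow> xt i = to_fract (a i) \<and> irreducible (a i)"
    using i_admissible_obtain[OF admissible] unfolding n_Ct by blast
  then have "regular (xt ` {1..nvars Ct})" by (auto simp: regular_def n_Ct)
  then show t: "to_fract (t i) = xt i" if "i \<in> {1..n}" for i
    using that by (intro to_fract_init_elem) (simp_all add: n_Ct)
  show "irreducible (t i)" if "i \<in> {1..n}" for i
    using t[OF that] a[OF that] by (metis to_fract_eq_iff)
qed

lemma prime_t: "i \<in> {1..n} \<Longrightarrow> prime_elem (t i)"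
  using irreducible_t by (simp add: prime_elem_iff_irreducible)

lemma t_not_dvd: "i \<in> {1..n} \<Longrightarrow> j \<in> {1..n} \<Longrightarrow> i \<noteq> j \<Longrightarrow> \<not> t i dvd t j"
  by (rule irreducible_cluster_variables_not_dvd[OF \<iota>t Ct_in])
    (simp_all add: n_Ct to_fract_t irreducible_t)

sublocale S: localization "b ` I" S
proof
  show "0 \<notin> b ` I"
  proof
    assume "0 \<in> b ` I"
    then obtain i where "i \<in> I" "b i = 0" by auto
    then show False using to_fract_b[of i] x_nonzero[of i] I_subset by auto
  qed
qed (simp_all add: S_def finite_I)

sublocale T: localization "t ` \<kappa> ` I" T
proof
  show "0 \<notin> t ` \<kappa> ` I"
  proof
    assume "0 \<in> t ` \<kappa> ` I"
    then obtain i where "i \<in> I" "t (\<kappa> i) = 0" by auto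
    then show False using irreducible_t[of "\<kappa> i"] \<kappa>_in[of i] I_subset by auto
  qed
qed (simp_all add: T_def finite_I)

lemma birational_extension: "\<exists>\<Phi>. ring_iso_on \<Phi> S T \<and> (\<forall>a\<in>A. \<Phi> a = Q a)"
proof -
  have "x ` I = to_fract ` b ` I"
    unfolding image_image by (rule image_cong) (use I_subset to_fract_b in auto)
  moreover have "xt ` marked_target C Ct \<kappa> = to_fract ` t ` \<kappa> ` I"
    unfolding \<kappa>_image_I[symmetric] image_image
    by (rule image_cong) (use I_subset to_fract_t \<kappa>_in in auto)
  ultimately show ?thesis
    using birational unfolding birational_def Let_def S_def T_def A_def by simp
qed

text \<open>\<open>\<Phi>\<close> is kept apart from \<open>Q\<close>: they are known to agree on
  \<open>A\<close>, while agreement at a mutated variable has to be proved.\<close>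

definition "\<Phi> = (SOME \<Phi>. ring_iso_on \<Phi> S T \<and> (\<forall>a\<in>A. \<Phi> a = Q a))"

lemma \<Phi>: "ring_iso_on \<Phi> S T" and \<Phi>_eq_Q: "a \<in> A \<Longrightarrow> \<Phi> a = Q a"
  using someI_ex[OF birational_extension] unfolding \<Phi>_def[symmetric] by auto

lemmas \<Phi>_mult = ring_iso_on_mult[OF \<Phi> S.subring_S]
  and \<Phi>_diff = ring_iso_on_diff[OF \<Phi> S.subring_S]
  and \<Phi>_in = ring_iso_on_in[OF \<Phi> S.subring_S]
  and \<Phi>_inj = ring_iso_on_inj[OF \<Phi> S.subring_S]
  and \<Phi>_surj = ring_iso_on_surj[OF \<Phi> S.subring_S]
  and \<Phi>_power = ring_iso_on_power[OF \<Phi> S.subring_S]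
  and \<Phi>_prod = ring_iso_on_prod[OF \<Phi> S.subring_S]
  and \<Phi>_of_nat = ring_iso_on_of_nat[OF \<Phi> S.subring_S]
  and \<Phi>_unit_in = ring_iso_on_unit_in[OF \<Phi> S.subring_S]

section \<open>Images of unmarked variables in the target\<close>

lemma x_in_poly_ring: "i \<in> {1..n} \<Longrightarrow> x i \<in> poly_ring C x"
  unfolding poly_ring_def by (rule hull_inc) simp

lemma poly_ring_subset_A: "poly_ring C x \<subseteq> A"
  unfolding A_def by (rule localize_superset)

lemma unit_in_marked: "j \<in> I \<Longrightarrow> unit_in T (xt (\<kappa> j))"
  using T.unit_in_generator[of "t (\<kappa> j)"] to_fract_t[OF \<kappa>_in[of j]] I_subset by auto

text \<open>The extra monomial in a quasi-isomorphism involves only marked variables. As long as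
  these are still the initial ones, they are units of \<open>T\<close>. The lemma is applied to the
  empty sequence and to a single mutation.\<close>

lemma Q_related:
  assumes "set ks \<subseteq> {1..rank C} - I" "i \<in> {1..n} - I"
    and marked: "\<And>j. j \<in> I \<Longrightarrow> fst (mutate_seq Ct (map \<kappa> ks)) (\<kappa> j) = xt (\<kappa> j)"
  shows "\<exists>w. unit_in T w \<and>
    Q (fst (mutate_seq C ks) i) = fst (mutate_seq Ct (map \<kappa> ks)) (\<kappa> i) * w"
proof -
  have "related_clusters C Ct \<kappa> (fst (mutate_seq C ks)) (fst (mutate_seq Ct (map \<kappa> ks)))"
    using assms(1) by (auto simp: related_clusters_def)
  then obtain \<mu> :: "nat \<Rightarrow> nat \<Rightarrow> int" where
    "Q (fst (mutate_seq C ks) i) = fst (mutate_seq Ct (map \<kappa> ks)) (\<kappa> i) *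
      (\<Prod>j\<in>I. fst (mutate_seq Ct (map \<kappa> ks)) (\<kappa> j) powi \<mu> i j)"
    using quasi assms(2) unfolding quasi_isomorphism_def by fastforce
  moreover have "unit_in T (\<Prod>j\<in>I. fst (mutate_seq Ct (map \<kappa> ks)) (\<kappa> j) powi \<mu> i j)"
    using unit_in_marked marked
    by (intro unit_in_prod unit_in_power_int T.subring_S) simp
  ultimately show ?thesis by blast
qed

lemma \<Phi>_x:
  assumes "i \<in> {1..n} - I"
  shows "\<exists>w. unit_in T w \<and> \<Phi> (x i) = to_fract (t (\<kappa> i)) * w"
  using Q_related[of "[]" i] assms x_in_poly_ring[of i] poly_ring_subset_A
    to_fract_t[OF \<kappa>_in[of i]]
  by (auto simp: mutate_seq_def \<Phi>_eq_Q subset_iff)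

text \<open>A prime that becomes a unit divides a generator, but distinct initial variables do not
  divide each other.\<close>

lemma t_not_unit: "i \<in> {1..n} - I \<Longrightarrow> \<not> unit_in T (to_fract (t (\<kappa> i)))"
proof
  assume i: "i \<in> {1..n} - I" and u: "unit_in T (to_fract (t (\<kappa> i)))"
  obtain j where j: "j \<in> I" "t (\<kappa> i) dvd t (\<kappa> j)"
    using T.prime_unit_in_dvd_generator[OF prime_t u] \<kappa>_in i by blast
  have "i = j"
    using t_not_dvd[of "\<kappa> i" "\<kappa> j"] j I_subset i \<kappa>_in \<kappa>_inj[of i j] by blast
  then show False using i j by simp
qed

lemma b_not_unit:
  assumes "i \<in> {1..n} - I" shows "\<not> unit_in S (to_fract (b i))"
proof
  assume u: "unit_in S (to_fract (b i))"
  obtain w where w: "unit_in T w" "\<Phi> (x i) = to_fract (t (\<kappa> i)) * w" using \<Phi>_x[OF assms] by blast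
  have "unit_in T (\<Phi> (to_fract (b i)))" using u \<Phi>_unit_in[of "to_fract (b i)"] by simp
  then have "unit_in T (\<Phi> (x i))" using to_fract_b[of i] assms by simp
  then have "unit_in T (to_fract (t (\<kappa> i)))"
    unfolding w(2) by (rule unit_in_mult_left[OF T.subring_S, rotated 2]) (use w(1) in \<open>auto simp: unit_in_def\<close>)
  then show False using t_not_unit[OF assms] by blast
qed

text \<open>Up to a unit of \<open>T\<close>, \<open>\<Phi>\<close> sends the variable to the prime
  \<open>t (\<kappa> i)\<close>, which is irreducible in \<open>T\<close>; the unit is absorbed into
  the second factor.\<close>

lemma b_mult:
  assumes i: "i \<in> {1..n} - I" and yz: "b i = y * z"
  shows "unit_in S (to_fract y) \<or> unit_in S (to_fract z)"
proof -
  obtain w where w: "unit_in T w" "\<Phi> (x i) = to_fract (t (\<kappa> i)) * w" using \<Phi>_x[OF i] by blast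
  have "\<Phi> (x i) = \<Phi> (to_fract y) * \<Phi> (to_fract z)"
    using to_fract_b[of i] i yz \<Phi>_mult[of "to_fract y" "to_fract z"] by simp
  then have "to_fract (t (\<kappa> i)) = \<Phi> (to_fract y) * (\<Phi> (to_fract z) * inverse w)"
    using w by (auto simp: unit_in_def field_simps)
  moreover have "\<Phi> (to_fract z) * inverse w \<in> T"
    using w(1) by (intro subring_set_mult[OF T.subring_S] \<Phi>_in) (auto simp: unit_in_def)
  ultimately have "unit_in T (\<Phi> (to_fract y)) \<or> unit_in T (\<Phi> (to_fract z) * inverse w)"
    using i by (intro T.prime_elem_mult_in_S[OF prime_t[OF \<kappa>_in] t_not_unit] \<Phi>_in) auto
  moreover have "unit_in T (\<Phi> (to_fract z))" if "unit_in T (\<Phi> (to_fract z) * inverse w)"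
    by (rule unit_in_mult_left[OF T.subring_S _ _ that])
      (use w(1) in \<open>auto simp: unit_in_def intro: \<Phi>_in\<close>)
  ultimately show ?thesis using \<Phi>_unit_in by auto
qed

text \<open>If \<open>q\<close> is no unit of \<open>S\<close>, its cofactors in \<open>b i\<close>
  and \<open>b j\<close> are units by \<open>b_mult\<close>. Then \<open>t (\<kappa> i)\<close> and
  \<open>t (\<kappa> j)\<close> both agree with the image of \<open>q\<close> up to units of
  \<open>T\<close>, so one divides the other.\<close>

lemma b_common_prime:
  assumes ij: "i \<in> {1..n} - I" "j \<in> {1..n} - I" "i \<noteq> j"
    and q: "q dvd b i" "q dvd b j"
  shows "unit_in S (to_fract q)"
proof (rule ccontr)
  assume not_unit: "\<not> unit_in S (to_fract q)"
  have *: "\<exists>v. unit_in T v \<and> \<Phi> (to_fract q) = to_fract (t (\<kappa> i)) * v"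
    if i: "i \<in> {1..n} - I" "q dvd b i" for i
  proof -
    obtain u where u: "b i = q * u" using i(2) by blast
    then have uu: "unit_in S (to_fract u)" using b_mult[OF i(1)] not_unit by blast
    obtain w where w: "unit_in T w" "\<Phi> (x i) = to_fract (t (\<kappa> i)) * w" using \<Phi>_x[OF i(1)] by blast
    have "unit_in T (\<Phi> (to_fract u))" using uu \<Phi>_unit_in by simp
    moreover have "\<Phi> (x i) = \<Phi> (to_fract q) * \<Phi> (to_fract u)"
      using to_fract_b[of i] i u \<Phi>_mult[of "to_fract q" "to_fract u"] by simp
    ultimately have "\<Phi> (to_fract q) = to_fract (t (\<kappa> i)) * (w * inverse (\<Phi> (to_fract u)))"
      "unit_in T (w * inverse (\<Phi> (to_fract u)))"
      using w unit_in_mult[OF T.subring_S w(1) unit_in_inverse]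
      by (simp_all add: unit_in_def[of T "\<Phi> (to_fract u)"] field_simps)
    then show ?thesis by blast
  qed
  obtain v where v: "unit_in T v" "\<Phi> (to_fract q) = to_fract (t (\<kappa> i)) * v"
    using *[OF ij(1) q(1)] by blast
  obtain w where w: "unit_in T w" "\<Phi> (to_fract q) = to_fract (t (\<kappa> j)) * w"
    using *[OF ij(2) q(2)] by blast
  have "to_fract (t (\<kappa> j)) = to_fract (t (\<kappa> i)) * (v * inverse w)"
    using v w by (auto simp: unit_in_def field_simps)
  moreover have "v * inverse w \<in> T"
    using v w by (auto simp: unit_in_def intro: subring_set_mult[OF T.subring_S])
  ultimately have "t (\<kappa> i) dvd t (\<kappa> j)"
    using ij(1) by (intro T.dvd_if_dvd_in_S[OF prime_t[OF \<kappa>_in] t_not_unit]) auto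
  then show False using t_not_dvd[of "\<kappa> i" "\<kappa> j"] \<kappa>_in \<kappa>_inj[of i j] ij by blast
qed

section \<open>Bound on the rank of the units of the localization\<close>

lemma \<iota>_unit: "c \<noteq> 0 \<Longrightarrow> \<iota> c dvd 1" and \<iota>t_unit: "c \<noteq> 0 \<Longrightarrow> \<iota>t c dvd 1"
  using \<iota>(2) \<iota>t(2) by auto

text \<open>\<open>\<Phi>\<close> is not assumed \<open>\<bbbK>\<close>-linear. If \<open>\<Phi> (g / h)\<close> is a constant, then \<open>g - m * h\<close> is a unit of \<open>S\<close>
  for all but at most one natural number \<open>m\<close>. These elements are pairwise coprime and only finitely
  many primes become units in \<open>S\<close>, so two of them are constants, and hence so are \<open>g\<close> and \<open>h\<close>.\<close>

lemma units_if_proportional_images: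
  assumes g: "unit_in S (to_fract g)" and h: "unit_in S (to_fract h)"
    and coprime: "\<And>q. prime_elem q \<Longrightarrow> q dvd g \<Longrightarrow> \<not> q dvd h"
    and eq: "\<Phi> (to_fract g) = to_fract (\<iota>t c) * \<Phi> (to_fract h)"
  shows "g dvd 1 \<and> h dvd 1"
proof -
  \<comment> \<open>Natural multiples are used because \<open>\<Phi>\<close> preserves them, while
    its values on constants of the base field are not prescribed.\<close>
  define e where "e m = g - of_nat m * h" for m
  have e_unit: "unit_in S (to_fract (e m))" if m: "of_nat m \<noteq> c" for m
  proof -
    have "to_fract (e m) = to_fract g - of_nat m * to_fract h"
      by (simp add: e_def to_fract_of_nat)
    then have "\<Phi> (to_fract (e m)) = \<Phi> (to_fract g) - of_nat m * \<Phi> (to_fract h)"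
      using \<Phi>_of_nat[of m] by (simp add: \<Phi>_diff \<Phi>_mult subring_set_mult[OF S.subring_S])
    also have "\<dots> = to_fract (\<iota>t (c - of_nat m)) * \<Phi> (to_fract h)"
      unfolding eq ring_hom_on_UNIV[OF \<iota>t(1)] ring_hom_on_UNIV_of_nat[OF \<iota>t(1)]
      by (simp add: to_fract_of_nat left_diff_distrib)
    finally have "unit_in T (\<Phi> (to_fract (e m)))"
      using T.unit_in_unit[OF \<iota>t_unit[of "c - of_nat m"]] m h \<Phi>_unit_in[of "to_fract h"]
      by (simp add: unit_in_mult[OF T.subring_S])
    then show ?thesis using \<Phi>_unit_in[of "to_fract (e m)"] by simp
  qed
  \<comment> \<open>For distinct indices the factor is a nonzero constant, as the characteristic is
    0. A common prime of \<open>e m\<close> and \<open>e m'\<close> therefore divides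
    \<open>h\<close> and then \<open>g\<close>.\<close>
  have diff: "e m - e m' = \<iota> (of_nat m' - of_nat m) * h" for m m'
    by (simp add: e_def ring_hom_on_UNIV[OF \<iota>(1)] ring_hom_on_UNIV_of_nat[OF \<iota>(1)] left_diff_distrib)
  have e_coprime: "\<not> q dvd e m'" if q: "prime_elem q" "q dvd e m" "m \<noteq> m'" for q m m'
  proof
    assume "q dvd e m'"
    then have "q dvd \<iota> (of_nat m' - of_nat m) * h" using q(2) diff[of m m'] by (metis dvd_diff)
    moreover have "\<iota> (of_nat m' - of_nat m) dvd 1" using q(3) by (intro \<iota>_unit) simp
    ultimately have "q dvd h" by (simp add: dvd_mult_unit_iff')
    moreover from this have "q dvd e m + of_nat m * h" using q(2) by simp
    then have "q dvd g" by (simp add: e_def)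
    ultimately show False using coprime[OF q(1)] by blast
  qed
  \<comment> \<open>The indices at which \<open>e m\<close> is known to be a unit of
    \<open>S\<close> without being a unit of R.\<close>
  define B where "B = {m. of_nat m \<noteq> c \<and> \<not> e m dvd 1}"
  have "\<exists>q. prime q \<and> q dvd e m" if "m \<in> B" for m
  proof -
    have "e m \<noteq> 0" "\<not> e m dvd 1" using e_unit[of m] that by (auto simp: B_def unit_in_def)
    then show ?thesis by (metis prime_divisorE)
  qed
  then obtain q where q: "\<And>m. m \<in> B \<Longrightarrow> prime (q m)" "\<And>m. m \<in> B \<Longrightarrow> q m dvd e m" by metis
  \<comment> \<open>Distinct indices in \<open>B\<close> have distinct primes \<open>q m\<close>,
    all of them among the finitely many primes that are units of \<open>S\<close>; so
    \<open>B\<close> is finite.\<close>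
  have "inj_on q B"
    using e_coprime q by (intro inj_onI) (metis prime_imp_prime_elem)
  moreover have "q ` B \<subseteq> {p. prime p \<and> unit_in S (to_fract p)}"
    using q S.unit_in_dvd[OF e_unit] by (auto simp: B_def)
  then have "finite (q ` B)" using S.finite_prime_units by (rule finite_subset)
  ultimately have "finite B" by (metis finite_imageD)
  moreover have "finite {m. of_nat m = c}"
    using finite_vimageI[of "{c}" "of_nat :: nat \<Rightarrow> 'k"] by (simp add: vimage_def inj_of_nat)
  ultimately have fin: "finite (B \<union> {m. of_nat m = c})" by simp
  obtain m where m: "m \<notin> B \<union> {m. of_nat m = c}"
    using ex_new_if_finite[OF infinite_UNIV_nat fin] by blast
  obtain m' where m': "m' \<notin> insert m (B \<union> {m. of_nat m = c})"
    using ex_new_if_finite[OF infinite_UNIV_nat, of "insert m (B \<union> {m. of_nat m = c})"] fin by blast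
  have "e m dvd 1" "e m' dvd 1" using m m' by (auto simp: B_def)
  then have "e m \<in> \<iota> ` (UNIV - {0})" "e m' \<in> \<iota> ` (UNIV - {0})" unfolding \<iota>(2)[symmetric] by auto
  then obtain k k' where k: "e m = \<iota> k" "e m' = \<iota> k'" by blast
  have const: "f dvd 1" if "f = \<iota> d" "f \<noteq> 0" for f d
    using \<iota>_unit[of d] that ring_hom_on_UNIV(1)[OF \<iota>(1)] by auto
  \<comment> \<open>Two constants \<open>e m\<close> and \<open>e m'\<close> differ by a nonzero
    constant multiple of \<open>h\<close>, which determines \<open>h\<close> as a constant.\<close>
  have "h = \<iota> (inverse (of_nat m' - of_nat m)) * (\<iota> (of_nat m' - of_nat m) * h)"
    using m' by (simp add: mult.assoc[symmetric] ring_hom_on_UNIV(2,4)[OF \<iota>(1), symmetric])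
  also have "\<dots> = \<iota> (inverse (of_nat m' - of_nat m) * (k - k'))"
    unfolding diff[of m m', symmetric] k by (simp add: ring_hom_on_UNIV[OF \<iota>(1)])
  finally obtain d where d: "h = \<iota> d" by blast
  have "g = e m + of_nat m * h" by (simp add: e_def)
  also have "\<dots> = \<iota> (k + of_nat m * d)"
    by (simp only: k d ring_hom_on_UNIV[OF \<iota>(1)] ring_hom_on_UNIV_of_nat[OF \<iota>(1)])
  finally show ?thesis using const[OF d] const[of g] g h by (auto simp: unit_in_def)
qed

text \<open>The images of the \<open>p l\<close> are constants times Laurent monomials in the marked
  target variables, so too many of them satisfy a multiplicative relation up to a constant.
  Separating exponents by sign gives coprime \<open>g\<close> and \<open>h\<close> with proportional
  images; \<open>units_if_proportional_images\<close> makes both units, although a prime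
  \<open>p l\<close> divides one of them.\<close>

lemma unit_rank:
  fixes L :: "nat set"
  assumes L: "finite L" and p: "\<And>l. l \<in> L \<Longrightarrow> prime_elem (p l) \<and> unit_in S (to_fract (p l))"
    and not_dvd: "\<And>l m. l \<in> L \<Longrightarrow> m \<in> L \<Longrightarrow> l \<noteq> m \<Longrightarrow> \<not> p l dvd p m"
  shows "card L \<le> card I"
proof (rule ccontr)
  assume "\<not> card L \<le> card I"
  then have card: "card (\<kappa> ` I) < card L" using card_image_le[OF finite_I, of \<kappa>] by simp
  define P where "P l = \<Phi> (to_fract (p l))" for l
  have t: "prime_elem (t j)" if "j \<in> \<kappa> ` I" for j using that I_subset \<kappa>_in prime_t by blast
  have P_unit: "unit_in T (P l)" if "l \<in> L" for l
    using p[OF that] \<Phi>_unit_in by (simp add: P_def)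
  have "\<exists>c \<alpha>. fract_unit c \<and> P l = c * (\<Prod>j\<in>\<kappa> ` I. to_fract (t j) powi \<alpha> j)" if "l \<in> L" for l
    using T.unit_in_monomial[OF refl finite_imageI[OF finite_I] t P_unit[OF that]] .
  then obtain c \<alpha> where c: "\<And>l. l \<in> L \<Longrightarrow> fract_unit (c l)"
    and P: "\<And>l. l \<in> L \<Longrightarrow> P l = c l * (\<Prod>j\<in>\<kappa> ` I. to_fract (t j) powi \<alpha> l j)"
    by metis
  obtain e where e: "\<exists>l\<in>L. e l \<noteq> 0" "\<And>j. j \<in> \<kappa> ` I \<Longrightarrow> (\<Sum>l\<in>L. e l * \<alpha> l j) = 0"
    using int_linear_dependency[OF finite_imageI[OF finite_I] L card, of \<alpha>] by blast
  \<comment> \<open>\<open>g\<close> collects the positive exponents and \<open>h\<close> the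
    negative ones; \<open>nat\<close> sends exponents of the wrong sign to 0, so no
    \<open>p l\<close> occurs in both.\<close>
  define g where "g = (\<Prod>l\<in>L. p l ^ nat (e l))"
  define h where "h = (\<Prod>l\<in>L. p l ^ nat (- e l))"
  have unit: "unit_in S (to_fract (\<Prod>l\<in>L. p l ^ k l))"
    and image: "\<Phi> (to_fract (\<Prod>l\<in>L. p l ^ k l)) = (\<Prod>l\<in>L. P l ^ k l)" for k
    using p by (auto simp: to_fract_prod to_fract_power \<Phi>_prod \<Phi>_power P_def
      subring_set_power[OF S.subring_S] intro!: unit_in_prod unit_in_power S.subring_S)
  have "(\<Prod>l\<in>L. P l powi e l) = (\<Prod>l\<in>L. c l powi e l)"
  proof -
    have "(\<Prod>l\<in>L. P l powi e l) =
        (\<Prod>l\<in>L. c l powi e l * (\<Prod>j\<in>\<kappa> ` I. to_fract (t j) powi (e l * \<alpha> l j)))"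
      by (rule prod.cong)
        (simp_all add: P power_int_mult_distrib prod_power_int power_int_mult[symmetric] mult.commute)
    also have "\<dots> = (\<Prod>l\<in>L. c l powi e l) *
        (\<Prod>j\<in>\<kappa> ` I. \<Prod>l\<in>L. to_fract (t j) powi (e l * \<alpha> l j))"
      by (simp only: prod.distrib prod.swap[of _ L])
    also have "(\<Prod>j\<in>\<kappa> ` I. \<Prod>l\<in>L. to_fract (t j) powi (e l * \<alpha> l j)) = 1"
    proof (rule prod.neutral, rule ballI)
      fix j assume j: "j \<in> \<kappa> ` I"
      have "to_fract (t j) \<noteq> 0" using t[OF j] by auto
      then show "(\<Prod>l\<in>L. to_fract (t j) powi (e l * \<alpha> l j)) = 1"
        using power_int_sum[of "to_fract (t j)" "\<lambda>l. e l * \<alpha> l j" L] e(2)[OF j] by simp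
    qed
    finally show ?thesis by simp
  qed
  also have "fract_unit \<dots>" by (intro fract_unit_prod fract_unit_power_int c)
  finally obtain u where u: "u dvd 1" "(\<Prod>l\<in>L. P l powi e l) = to_fract u"
    by (auto simp: fract_unit_def)
  have "u \<in> \<iota>t ` (UNIV - {0})" using u(1) unfolding \<iota>t(2)[symmetric] by simp
  then obtain k where k: "u = \<iota>t k" by blast
  \<comment> \<open>Moving the negative exponents to the other side turns the relation into one
    between \<open>g\<close> and \<open>h\<close>.\<close>
  have "(\<Prod>l\<in>L. P l powi e l) * (\<Prod>l\<in>L. P l ^ nat (- e l)) = (\<Prod>l\<in>L. P l ^ nat (e l))"
    unfolding prod.distrib[symmetric]
    by (rule prod.cong) (use P_unit in \<open>auto simp: unit_in_def power_int_def power_inverse\<close>)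
  then have "\<Phi> (to_fract g) = to_fract (\<iota>t k) * \<Phi> (to_fract h)"
    unfolding g_def h_def image by (simp add: u(2) k)
  moreover have "\<not> q dvd h" if q: "prime_elem q" "q dvd g" for q
  proof
    assume "q dvd h"
    have *: "\<exists>l\<in>L. q dvd p l \<and> p l dvd q \<and> k l \<noteq> 0" if dvd: "q dvd (\<Prod>l\<in>L. p l ^ k l)" for k
    proof -
      obtain l where l: "l \<in> L" "q dvd p l ^ k l"
        using dvd prime_dvd_prod_iff[OF L, of "normalize q" "\<lambda>l. p l ^ k l"] q(1) by auto
      have k: "k l \<noteq> 0" using l(2) prime_elem_not_unit[OF q(1)] by (metis power_0)
      have "q dvd p l" using prime_elem_dvd_power[OF q(1) l(2)] .
      moreover obtain v where "v dvd 1" "p l = v * q"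
        using irreducible_dvd_irreducible[of q "p l"] q(1) p[OF l(1)] calculation
        by (auto simp: prime_elem_iff_irreducible)
      then have "p l dvd q" by simp
      ultimately show ?thesis using l(1) k by blast
    qed
    \<comment> \<open>Through \<open>q\<close>, \<open>p l\<close> divides \<open>p m\<close>, so
      \<open>l = m\<close>; but \<open>e l\<close> is positive and \<open>e m\<close>
      negative.\<close>
    obtain l m where "l \<in> L" "m \<in> L" "p l dvd q" "q dvd p m" "nat (e l) \<noteq> 0" "nat (- e m) \<noteq> 0"
      using *[OF q(2)[unfolded g_def]] *[OF \<open>q dvd h\<close>[unfolded h_def]] by blast
    then show False using not_dvd[of l m] by (metis dvd_trans nat_0_iff neg_le_0_iff_le nle_le)
  qed
  ultimately have "g dvd 1" "h dvd 1"
    using units_if_proportional_images[of g h k] unit by (auto simp: g_def h_def)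
  moreover obtain l where l: "l \<in> L" "e l \<noteq> 0" using e(1) by blast
  have "p l ^ nat (e l) dvd g" "p l ^ nat (- e l) dvd h"
    unfolding g_def h_def using L l(1) by (rule dvd_prodI)+
  moreover have "p l dvd p l ^ nat (e l)" if "e l > 0" using that by (intro dvd_power) simp
  moreover have "p l dvd p l ^ nat (- e l)" if "e l < 0" using that by (intro dvd_power) simp
  ultimately have "p l dvd 1" using l(2) by (metis dvd_trans linorder_neqE)
  then show False using p[OF l(1)] prime_elem_not_unit by blast
qed

section \<open>Passage to irreducibility and mutations\<close>

lemma marked_localization: "marked_localization n I b S"
proof
  show "b i \<noteq> 0" if "i \<in> {1..n}" for i
    using to_fract_b[OF that] x_nonzero[OF that] by auto
  show "card L \<le> card I"
    if "finite L" "\<And>l. l \<in> L \<Longrightarrow> prime_elem (p l) \<and> unit_in S (to_fract (p l))"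
      "\<And>l m. l \<in> L \<Longrightarrow> m \<in> L \<Longrightarrow> l \<noteq> m \<Longrightarrow> \<not> p l dvd p m" for L :: "nat set" and p
    using that by (rule unit_rank)
qed (use I_subset b_not_unit b_mult b_common_prime in auto)

text \<open>Irreducibility of the variables is a hypothesis here because its proof needs both
  triples, while this context contains only one.\<close>

lemma regular_coprime_mutation:
  assumes k: "k \<in> {1..rank C} - I" and irreducible_b: "\<And>i. i \<in> {1..n} \<Longrightarrow> irreducible (b i)"
  shows "\<exists>a. fst (mutate C k (init_seed C)) k = to_fract a \<and> coprime_elems a (b k)"
proof -
  define y where "y = fst (mutate C k (init_seed C)) k"
  define yt where "yt = fst (mutate Ct (\<kappa> k) (init_seed Ct)) (\<kappa> k)"
  have kn: "k \<in> {1..n} - I" "k \<in> {1..n}" using k by auto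
  \<comment> \<open>Hence mutating the target at \<open>\<kappa> k\<close> leaves the marked
    variables unchanged, as \<open>Q_related\<close> requires.\<close>
  have other: "\<kappa> j \<noteq> \<kappa> k" if "j \<in> I" for j using \<kappa>_inj[of j k] that I_subset kn by blast
  obtain w where w: "unit_in T w" "Q y = yt * w"
    using Q_related[of "[k]" k] k kn(1) other
    by (auto simp: mutate_seq_def fst_mutate_other y_def yt_def)
  obtain s where s: "yt = to_fract s" "coprime_elems s (t (\<kappa> k))"
    using i_admissible_mutation[OF admissible \<kappa>_mutable[OF k] to_fract_t[OF \<kappa>_in[OF kn(2)], symmetric]]
    unfolding yt_def by blast
  then have s_not_dvd: "\<not> t (\<kappa> k) dvd s"
    using coprime_elems_prime_elem_iff[OF prime_t[OF \<kappa>_in[OF kn(2)]]] by blast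
  have x0: "x k \<noteq> 0" using x_nonzero[OF kn(2)] .
  have yx: "y * x k \<in> poly_ring C x" unfolding y_def by (rule mutation_mult_in_poly_ring[OF x0])
  have xS: "x k \<in> S" using S.to_fract_in_S[of "b k"] to_fract_b[OF kn(2)] by simp
  \<comment> \<open>\<open>Q\<close> is multiplicative on the ambient field, so \<open>y\<close>
    must first be shown to lie there.\<close>
  have ambient: "subfield_set (ambient_field C)"
    unfolding ambient_field_def by (rule subfield_set_hull)
  then have sub: "subring_set (ambient_field C)" by (simp add: subfield_set_def)
  have "x ` {1..n} \<subseteq> ambient_field C" unfolding ambient_field_def by (rule hull_subset)
  then have "poly_ring C x \<subseteq> ambient_field C" "x k \<in> ambient_field C"
    using kn(2) hull_minimal[of _ _ subring_set, OF _ sub] unfolding poly_ring_def by blast+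
  moreover from this have "y * x k * inverse (x k) \<in> ambient_field C"
    using ambient yx unfolding subfield_set_def by - (rule subring_set_mult[OF sub], blast+)
  then have "y \<in> ambient_field C" using x0 by (simp add: mult.assoc)
  ultimately have Q_yx: "Q (y * x k) = Q y * Q (x k)"
    using quasi ring_iso_on_mult[OF _ sub] unfolding quasi_isomorphism_def by blast
  \<comment> \<open>A preimage \<open>y0\<close> of \<open>Q y\<close> under \<open>\<Phi>\<close>
    exists in \<open>S\<close>. Since \<open>y * x k\<close> lies in \<open>A\<close>, where
    \<open>\<Phi>\<close> and \<open>Q\<close> agree, injectivity identifies \<open>y0\<close> with
    \<open>y\<close>.\<close>
  have "Q y \<in> T" using w s(1) by (auto simp: unit_in_def intro: subring_set_mult[OF T.subring_S])
  then obtain y0 where y0: "y0 \<in> S" "Q y = \<Phi> y0" using \<Phi>_surj by blast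
  have A: "y * x k \<in> A" "x k \<in> A" using poly_ring_subset_A yx x_in_poly_ring[OF kn(2)] by auto
  have poly_R: "poly_ring C x \<subseteq> range to_fract"
    using regular_C unfolding poly_ring_def regular_def
    by (intro hull_minimal subring_set_range_to_fract) auto
  then obtain r where r: "y * x k = to_fract r" using yx by auto
  have "\<Phi> (y0 * x k) = \<Phi> (y * x k)"
    using \<Phi>_mult[OF y0(1) xS] y0(2) Q_yx \<Phi>_eq_Q[OF A(1)] \<Phi>_eq_Q[OF A(2)] by simp
  then have "y0 * x k = y * x k"
    using \<Phi>_inj y0(1) xS r by (simp add: inj_on_eq_iff subring_set_mult[OF S.subring_S])
  then have yS: "y \<in> S" "\<Phi> y = Q y" using x0 y0 by auto

  have b_not_dvd: "\<not> b k dvd b j" if "j \<in> I" for j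
  proof -
    have j: "j \<in> {1..n}" "k \<noteq> j" using that I_subset kn(1) by auto
    show ?thesis
      by (rule irreducible_cluster_variables_not_dvd[OF \<iota> C_in kn(2) j])
        (fact to_fract_b[OF kn(2), symmetric] to_fract_b[OF j(1), symmetric]
          irreducible_b[OF kn(2)] irreducible_b[OF j(1)])+
  qed
  have prime_b: "prime_elem (b k)" using irreducible_b[OF kn(2)] by (simp add: prime_elem_iff_irreducible)
  \<comment> \<open>A prime dividing \<open>b k\<close> is associated to it and so divides no marked
    variable; there \<open>S\<close> lies in \<open>loc_at p\<close>. At every other prime the
    exchange relation writes \<open>y\<close> with the harmless denominator
    \<open>b k\<close>.\<close>
  have "y \<in> range to_fract"
  proof (rule range_to_fract_if_loc_at)
    fix p :: 'a assume p: "prime_elem p"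
    show "y \<in> loc_at p"
    proof (cases "p dvd b k")
      case True
      then obtain u where "u dvd 1" "b k = u * p"
        using irreducible_dvd_irreducible[of p "b k"] p irreducible_b[OF kn(2)]
        by (auto simp: prime_elem_iff_irreducible)
      then have "\<not> p dvd b j" if "j \<in> I" for j
        using b_not_dvd[OF that] by (simp add: mult_unit_dvd_iff')
      then show ?thesis using S.S_subset_loc_at[OF p] yS(1) by blast
    next
      case False
      have "y = to_fract r / to_fract (b k)"
        using r x0 to_fract_b[OF kn(2)] by (simp add: field_simps)
      then show ?thesis using loc_atI[OF False] by simp
    qed
  qed
  then obtain a where a: "y = to_fract a" by blast
  \<comment> \<open>Applying \<open>\<Phi>\<close> to such a factorization makes
    \<open>t (\<kappa> k)\<close> divide \<open>s\<close> in \<open>T\<close>;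
    \<open>dvd_if_dvd_in_S\<close> brings this back to the target ring.\<close>
  have "\<not> b k dvd a"
  proof
    assume "b k dvd a"
    then obtain d where d: "a = b k * d" by blast
    obtain v where v: "unit_in T v" "\<Phi> (x k) = to_fract (t (\<kappa> k)) * v" using \<Phi>_x[OF kn(1)] by blast
    have "y = x k * to_fract d" using a d to_fract_b[OF kn(2)] by simp
    then have "yt * w = to_fract (t (\<kappa> k)) * v * \<Phi> (to_fract d)"
      using yS(2) w(2) \<Phi>_mult[OF xS S.to_fract_in_S[of d]] v(2) by simp
    then have "to_fract s = to_fract (t (\<kappa> k)) * (v * \<Phi> (to_fract d) * inverse w)"
      using s(1) w(1) by (simp add: unit_in_def field_simps)
    moreover have "v * \<Phi> (to_fract d) * inverse w \<in> T"
      using v(1) w(1) by (intro subring_set_mult[OF T.subring_S] \<Phi>_in) (auto simp: unit_in_def)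
    ultimately have "t (\<kappa> k) dvd s"
      by (intro T.dvd_if_dvd_in_S[OF prime_t[OF \<kappa>_in[OF kn(2)]] t_not_unit[OF kn(1)]])
    then show False using s_not_dvd by blast
  qed
  then show ?thesis
    using a coprime_elems_prime_elem_iff[OF prime_b] unfolding y_def by blast
qed

end

section \<open>Combination of the two triples\<close>

theorem proposition4p6:
  fixes \<iota> :: "'k::field_char_0 \<Rightarrow> 'a::{idom, factorial_semiring}"
    and \<iota>t :: "'k \<Rightarrow> 'b::{idom, factorial_semiring}"
    and \<iota>h :: "'k \<Rightarrow> 'c::{idom, factorial_semiring}"
    and C :: "'a fract cluster_structure"
    and Ct :: "'b fract cluster_structure"
    and Ch :: "'c fract cluster_structure"
    and \<kappa> \<kappa>' :: "nat \<Rightarrow> nat"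
    and Q :: "'a fract \<Rightarrow> 'b fract"
    and Q' :: "'a fract \<Rightarrow> 'c fract"
  assumes "ring_hom_on UNIV \<iota>" and "ring_hom_on UNIV \<iota>t" and "ring_hom_on UNIV \<iota>h"
    and "noetherian TYPE('a)" and "noetherian TYPE('b)" and "noetherian TYPE('c)"
    and "{a. a dvd 1} = \<iota> ` (UNIV - {0})"
    and "{a. a dvd 1} = \<iota>t ` (UNIV - {0})"
    and "{a. a dvd 1} = \<iota>h ` (UNIV - {0})"
    and "cluster_structure_in \<iota> C"
    and "cluster_structure_in \<iota>t Ct"
    and "cluster_structure_in \<iota>h Ch"
    and "related_triple C Ct \<kappa>" and "related_triple C Ch \<kappa>'"
    and "quasi_isomorphism C Ct \<kappa> Q" and "birational C Ct \<kappa> Q"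
    and "quasi_isomorphism C Ch \<kappa>' Q'" and "birational C Ch \<kappa>' Q'"
    and "marked_source C Ct \<kappa> \<inter> marked_source C Ch \<kappa>' = {}"
    and "i_admissible Ct (init_cluster Ct ` {1..nvars Ct})"
    and "i_admissible Ch (init_cluster Ch ` {1..nvars Ch})"
    and "regular (init_cluster C ` {1..nvars C})"
  shows "i_admissible C (init_cluster C ` {1..nvars C}) \<and>
    upper_cluster_algebra_over \<iota>h Ch \<subseteq> range to_fract \<and>
    upper_cluster_algebra_over \<iota>t Ct \<subseteq> range to_fract \<and>
    upper_cluster_algebra_over \<iota> C \<subseteq> range to_fract"
proof -
  interpret T: birational_quasi_isomorphism \<iota> \<iota>t C Ct \<kappa> Q
    by unfold_locales (fact assms)+
  interpret H: birational_quasi_isomorphism \<iota> \<iota>h C Ch \<kappa>' Q'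
    by unfold_locales (fact assms)+
  have irreducible: "irreducible (init_elem C i)" if "i \<in> {1..nvars C}" for i
    using irreducible_if_complementary[OF T.marked_localization H.marked_localization assms(19) that] .
  have mutation: "\<exists>a. fst (mutate C k (init_seed C)) k = to_fract a \<and> coprime_elems a (init_elem C k)"
    if k: "k \<in> {1..rank C}" for k
  \<comment> \<open>A direction marked for the first triple is unmarked for the second, so one of
    the two triples always handles the mutation.\<close>
  proof (cases "k \<in> marked_source C Ct \<kappa>")
    case True
    then have "k \<in> {1..rank C} - marked_source C Ch \<kappa>'" using k assms(19) by blast
    then show ?thesis by (rule H.regular_coprime_mutation[OF _ irreducible])
  next
    case False
    then have "k \<in> {1..rank C} - marked_source C Ct \<kappa>" using k by blast
    then show ?thesis by (rule T.regular_coprime_mutation[OF _ irreducible])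
  qed
  have adm: "i_admissible C (init_cluster C ` {1..nvars C})"
    unfolding i_admissible_def
  proof (intro conjI ballI impI subset_refl)
    show "\<exists>a. x = to_fract a \<and> irreducible a" if "x \<in> init_cluster C ` {1..nvars C}" for x
      using that irreducible T.to_fract_b by (metis imageE)
    show "\<exists>a a'. init_cluster C k = to_fract a \<and> fst (mutate C k (init_seed C)) k = to_fract a' \<and>
        coprime_elems a' a" if "k \<in> {1..rank C}" for k
    proof -
      have "init_cluster C k = to_fract (init_elem C k)" using T.to_fract_b[of k] that by simp
      then show ?thesis using mutation[OF that] by blast
    qed
  qed
  show ?thesis
    using adm upper_cluster_algebra_over_subset[OF assms(1,7,10) adm]
      upper_cluster_algebra_over_subset[OF assms(2,8,11,20)]
      upper_cluster_algebra_over_subset[OF assms(3,9,12,21)] by blast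
qed

end
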